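(* Let $G$ be a finite group and $p$ a prime. Let $\mathcal X^c$ be the set of $G$-conjugacy classes of $p$-selfcentralizing $p$-subgroups of $G$; sums $\sum_{[H]},\sum_{[K]}$ run over $\mathcal X^c$ and sums $\sum_H$ over $p$-selfcentralizing $p$-subgroups $H$. Then the following give, for each category, a weighting $k^{[H]}$ on $\mathcal X^c$, a coweighting $k_K$ on objects, and the Euler characteristic: (i) $\mathcal T^c_G$: $k^{[H]}=\sum_{[K]}[\mu]([H],[K])$, $k_K=|G|^{-1}\sum_H\mu(H,K)$, $\chi=\sum_{[H],[K]}[\mu]([H],[K])$; (ii) $\mathcal L^c_G$: $k^{[H]}=\sum_{[K]}[\mu]([H],[K])|C_G(K)|_{p'}$, $k_K=|G|^{-1}|C_G(K)|_{p'}\sum_H\mu(H,K)$, $\chi=\sum_{[H],[K]}[\mu]([H],[K])|C_G(K)|_{p'}$; (iii) $\mathcal F^c_G$: $k^{[H]}=\sum_{[K]}[\mu]([H],[K])|C_G(K)|$, $k_K=|G|^{-1}|C_G(K)|\sum_H\mu(H,K)$, $\chi=\sum_{[H],[K]}[\mu]([H],[K])|C_G(K)|$; (iv) $\mathcal O^c_G$: $k^{[H]}=|H|\sum_{[K]}[\mu]([H],[K])$, $k_K=|G|^{-1}\sum_H|H|\mu(H,K)$, $\chi=\sum_{[H],[K]}|H|[\mu]([H],[K])$; (v) $\widetilde{\mathcal F}^c_G$: $k^{[H]}=|H|\sum_{[K]}[\mu]([H],[K])|C_G(K)|_{p'}$, $k_K=|G|^{-1}|C_G(K)|_{p'}\sum_H|H|\mu(H,K)$,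 $\chi=\sum_{[H],[K]}|H|[\mu]([H],[K])|C_G(K)|_{p'}$.
   Context: A $p$-subgroup $H\le G$ is $p$-selfcentralizing if $Z(H)=C_H(H)$ is a Sylow $p$-subgroup of $C_G(H)$. $N_G(H,K)=\{g\in G:g^{-1}Hg\le K\}$; $O^p(X)$ is the smallest normal subgroup of $X$ with $p$-group quotient; $n_{p'}$ is the largest divisor of $n$ prime to $p$. The categories $\mathcal T^c_G,\mathcal L^c_G,\mathcal F^c_G,\mathcal O^c_G,\widetilde{\mathcal F}^c_G$ have as objects the $p$-selfcentralizing $p$-subgroups of $G$, with morphisms $N_G(H,K)$, $O^p(C_G(H))\backslash N_G(H,K)$, $C_G(H)\backslash N_G(H,K)$, $N_G(H,K)/K$, $C_G(H)\backslash N_G(H,K)/K$ respectively, composition induced by multiplication. For such $\mathcal C$, $|\mathcal C(H,K)|$ depends only on conjugacy classes; a weighting on $\mathcal X^c$ is a function $k^{[\bullet]}$ with $\sum_{[K]\in\mathcal X^c}|\mathcal C(H,K)|k^{[K]}=1$ for every object $H$; a coweighting is $k_\bullet:\mathrm{Ob}(\mathcal C)\to\mathbb Q$ with $\sum_Hk_H|\mathcal C(H,K)|=1$ for every object $K$; $\chi$ is Leinster's Euler characteristic (sum of the values of a weighting or coweighting of $\mathcal C$, when both exist). $\mu(H,K)$ is the Möbius function of the poset of all subgroups of $G$, and $[\mu]([H],[K])=|N_G(H)|^{-1}\sum_{L\in[K]}\mu(H,L)$, $[K]$ the set of $G$-conjugates of $K$. *)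

theory Defs
  imports "HOL-Algebra.Algebra" "HOL-Computational_Algebra.Primes"
begin

definition conjg :: "('a, 'b) monoid_scheme \<Rightarrow> 'a \<Rightarrow> 'a set \<Rightarrow> 'a set" where
  "conjg G g H = {inv\<^bsub>G\<^esub> g \<otimes>\<^bsub>G\<^esub> h \<otimes>\<^bsub>G\<^esub> g | h. h \<in> H}"

definition conjclass :: "('a, 'b) monoid_scheme \<Rightarrow> 'a set \<Rightarrow> 'a set set" where
  "conjclass G K = {conjg G g K | g. g \<in> carrier G}"

definition centralizer :: "('a, 'b) monoid_scheme \<Rightarrow> 'a set \<Rightarrow> 'a set" where
  "centralizer G H = {g \<in> carrier G. \<forall>h \<in> H. g \<otimes>\<^bsub>G\<^esub> h = h \<otimes>\<^bsub>G\<^esub> g}"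

definition transporter :: "('a, 'b) monoid_scheme \<Rightarrow> 'a set \<Rightarrow> 'a set \<Rightarrow> 'a set" where
  "transporter G H K = {g \<in> carrier G. conjg G g H \<subseteq> K}"

definition p_subgroup :: "('a, 'b) monoid_scheme \<Rightarrow> nat \<Rightarrow> 'a set \<Rightarrow> bool" where
  "p_subgroup G p H \<longleftrightarrow> subgroup H G \<and> (\<exists>n. card H = p ^ n)"

definition sylow_of :: "('a, 'b) monoid_scheme \<Rightarrow> nat \<Rightarrow> 'a set \<Rightarrow> 'a set \<Rightarrow> bool" where
  "sylow_of G p P S \<longleftrightarrow> p_subgroup G p P \<and> P \<subseteq> S \<and> card P = p ^ Factorial_Ring.multiplicity p (card S)"

definition p_selfcentralizing :: "('a, 'b) monoid_scheme \<Rightarrow> nat \<Rightarrow> 'a set \<Rightarrow> bool" where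
  "p_selfcentralizing G p H \<longleftrightarrow> sylow_of G p (H \<inter> centralizer G H) (centralizer G H)"

definition objs :: "('a, 'b) monoid_scheme \<Rightarrow> nat \<Rightarrow> 'a set set" where
  "objs G p = {H. p_subgroup G p H \<and> p_selfcentralizing G p H}"

definition Xc :: "('a, 'b) monoid_scheme \<Rightarrow> nat \<Rightarrow> 'a set set set" where
  "Xc G p = conjclass G ` objs G p"

definition rep :: "'a set set \<Rightarrow> 'a set" where
  "rep c = (SOME K. K \<in> c)"

text \<open>O^p(S): the smallest normal subgroup of S with p-group quotient
  (the intersection of all such normal subgroups).\<close>
definition Op :: "('a, 'b) monoid_scheme \<Rightarrow> nat \<Rightarrow> 'a set \<Rightarrow> 'a set" where
  "Op G p S = \<Inter> {N. N \<subseteq> S \<and> normal N (G\<lparr>carrier := S\<rparr>) \<and> (\<exists>n. card S = p ^ n * card N)}"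

definition p'_part :: "nat \<Rightarrow> nat \<Rightarrow> nat" where
  "p'_part p n = n div p ^ Factorial_Ring.multiplicity p n"

function mu :: "('a, 'b) monoid_scheme \<Rightarrow> 'a set \<Rightarrow> 'a set \<Rightarrow> int" where
  "mu G H K = (if H = K then 1
     else if H \<subset> K \<and> finite K
       then - (\<Sum>L \<in> {L. subgroup L G \<and> H \<subseteq> L \<and> L \<subset> K}. mu G H L)
     else 0)"
  by auto
termination
  apply (relation "inv_image finite_psubset (\<lambda>(G, H, K). K)")
   apply (rule wf_inv_image, rule wf_finite_psubset)
  apply (auto simp: finite_psubset_def)
  done

definition mu_cl :: "('a, 'b) monoid_scheme \<Rightarrow> 'a set \<Rightarrow> 'a set \<Rightarrow> rat" where
  "mu_cl G H K = (\<Sum>L \<in> conjclass G K. of_int (mu G H L)) / of_nat (card (normalizer G H))"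

definition mor_T :: "('a, 'b) monoid_scheme \<Rightarrow> nat \<Rightarrow> 'a set \<Rightarrow> 'a set \<Rightarrow> 'a set set" where
  "mor_T G p H K = (\<lambda>g. {g}) ` transporter G H K"

definition mor_L :: "('a, 'b) monoid_scheme \<Rightarrow> nat \<Rightarrow> 'a set \<Rightarrow> 'a set \<Rightarrow> 'a set set" where
  "mor_L G p H K = (\<lambda>g. Op G p (centralizer G H) #>\<^bsub>G\<^esub> g) ` transporter G H K"

definition mor_F :: "('a, 'b) monoid_scheme \<Rightarrow> nat \<Rightarrow> 'a set \<Rightarrow> 'a set \<Rightarrow> 'a set set" where
  "mor_F G p H K = (\<lambda>g. centralizer G H #>\<^bsub>G\<^esub> g) ` transporter G H K"

definition mor_O :: "('a, 'b) monoid_scheme \<Rightarrow> nat \<Rightarrow> 'a set \<Rightarrow> 'a set \<Rightarrow> 'a set set" where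
  "mor_O G p H K = (\<lambda>g. g <#\<^bsub>G\<^esub> K) ` transporter G H K"

definition mor_Ft :: "('a, 'b) monoid_scheme \<Rightarrow> nat \<Rightarrow> 'a set \<Rightarrow> 'a set \<Rightarrow> 'a set set" where
  "mor_Ft G p H K = (\<lambda>g. (centralizer G H #>\<^bsub>G\<^esub> g) <#>\<^bsub>G\<^esub> K) ` transporter G H K"

text \<open>A weighting on X^c (values on conjugacy classes; |C(H,K)| depends only on classes).\<close>
definition is_class_weighting ::
  "'a set set set \<Rightarrow> 'a set set \<Rightarrow> ('a set \<Rightarrow> 'a set \<Rightarrow> 'c set) \<Rightarrow> ('a set set \<Rightarrow> rat) \<Rightarrow> bool" where
  "is_class_weighting Xs Ob Hm k \<longleftrightarrow>
     (\<forall>H \<in> Ob. (\<Sum>c \<in> Xs. of_nat (card (Hm H (rep c))) * k c) = 1)"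

definition is_weighting :: "'a set set \<Rightarrow> ('a set \<Rightarrow> 'a set \<Rightarrow> 'c set) \<Rightarrow> ('a set \<Rightarrow> rat) \<Rightarrow> bool" where
  "is_weighting Ob Hm k \<longleftrightarrow> (\<forall>H \<in> Ob. (\<Sum>K \<in> Ob. of_nat (card (Hm H K)) * k K) = 1)"

definition is_coweighting :: "'a set set \<Rightarrow> ('a set \<Rightarrow> 'a set \<Rightarrow> 'c set) \<Rightarrow> ('a set \<Rightarrow> rat) \<Rightarrow> bool" where
  "is_coweighting Ob Hm k \<longleftrightarrow> (\<forall>K \<in> Ob. (\<Sum>H \<in> Ob. k H * of_nat (card (Hm H K))) = 1)"

text \<open>Leinster: the Euler characteristic exists if the category has both a weighting
  and a coweighting; it is then the sum of the values of a weighting.\<close>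
definition has_euler_char :: "'a set set \<Rightarrow> ('a set \<Rightarrow> 'a set \<Rightarrow> 'c set) \<Rightarrow> bool" where
  "has_euler_char Ob Hm \<longleftrightarrow> (\<exists>k. is_weighting Ob Hm k) \<and> (\<exists>k. is_coweighting Ob Hm k)"

definition euler_char :: "'a set set \<Rightarrow> ('a set \<Rightarrow> 'a set \<Rightarrow> 'c set) \<Rightarrow> rat" where
  "euler_char Ob Hm = (\<Sum>K \<in> Ob. (SOME k. is_weighting Ob Hm k) K)"

end

theory Submission
  imports Defs
begin

text \<open>
  In each of the five categories the set of morphisms from \<open>H\<close> to \<open>K\<close> consists of the double cosets
  \<open>A g B\<close> in the transporter of \<open>H\<close> into \<open>K\<close>, with \<open>A \<le> C(H)\<close> and \<open>B \<le> K\<close>, and all these double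
  cosets have the same size \<open>a(H) b(K)\<close>. For \<open>O\<^sup>p(C(H))\<close> this uses that the central Sylow subgroup
  \<open>Z(H)\<close> of \<open>C(H)\<close> has a normal complement; for \<open>C(H)\<close> and \<open>K\<close> together it uses that
  \<open>C(H\<^sup>g) \<inter> K = Z(H\<^sup>g)\<close> whenever \<open>H\<^sup>g \<le> K\<close>. Hence the matrix of hom-set sizes is the transporter
  matrix scaled by diagonal matrices. The transporter matrix is the sum over \<open>g\<close> of the inclusion
  relations \<open>H\<^sup>g \<le> K\<close>, and since the objects are closed under passing to larger \<open>p\<close>-subgroups,
  Moebius inversion over them agrees with Moebius inversion over all subgroups.
\<close>

declare mu.simps [simp del]

subsection \<open>Conjugation\<close>

context group
begin

lemma mult_inv_cancel_left:
  assumes "x \<in> carrier G" "y \<in> carrier G"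
  shows "x \<otimes> (inv x \<otimes> y) = y" "inv x \<otimes> (x \<otimes> y) = y"
  using assms by (simp_all flip: m_assoc)

lemma conjg_eq_image: "conjg G g H = (\<lambda>h. inv g \<otimes> h \<otimes> g) ` H"
  by (auto simp: conjg_def)

lemma conjg_mono: "H \<subseteq> K \<Longrightarrow> conjg G g H \<subseteq> conjg G g K"
  by (auto simp: conjg_eq_image)

lemma conjg_subset_carrier: "g \<in> carrier G \<Longrightarrow> H \<subseteq> carrier G \<Longrightarrow> conjg G g H \<subseteq> carrier G"
  by (auto simp: conjg_eq_image)

lemma inj_on_conj: "g \<in> carrier G \<Longrightarrow> inj_on (\<lambda>h. inv g \<otimes> h \<otimes> g) (carrier G)"
  by (auto simp: inj_on_def)

lemma card_conjg: "g \<in> carrier G \<Longrightarrow> H \<subseteq> carrier G \<Longrightarrow> card (conjg G g H) = card H"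
  unfolding conjg_eq_image by (rule card_image, rule inj_on_subset[OF inj_on_conj])

lemma conjg_one: "H \<subseteq> carrier G \<Longrightarrow> conjg G \<one> H = H"
  unfolding conjg_eq_image by (force simp: image_iff)

text \<open>The convention \<open>g^-1 h g\<close> makes conjugation a right action, so conjugators
  multiply in the order in which they are applied.\<close>

lemma conjg_conjg:
  assumes "g \<in> carrier G" "h \<in> carrier G" "H \<subseteq> carrier G"
  shows "conjg G h (conjg G g H) = conjg G (g \<otimes> h) H"
  unfolding conjg_eq_image image_image
  using assms by (intro image_cong) (auto simp: inv_mult_group m_assoc subset_iff)

lemma conjg_inv_conjg:
  "g \<in> carrier G \<Longrightarrow> H \<subseteq> carrier G \<Longrightarrow> conjg G (inv g) (conjg G g H) = H"
  "g \<in> carrier G \<Longrightarrow> H \<subseteq> carrier G \<Longrightarrow> conjg G g (conjg G (inv g) H) = H"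
  by (simp_all add: conjg_conjg conjg_one)

lemma conjg_subset_iff:
  assumes "g \<in> carrier G" "H \<subseteq> carrier G" "K \<subseteq> carrier G"
  shows "conjg G g H \<subseteq> conjg G g K \<longleftrightarrow> H \<subseteq> K"
  using assms conjg_mono[of H K g] conjg_mono[of "conjg G g H" "conjg G g K" "inv g"]
  by (auto simp: conjg_inv_conjg)

lemma conjg_eq_iff:
  assumes "g \<in> carrier G" "H \<subseteq> carrier G" "K \<subseteq> carrier G"
  shows "conjg G g H = conjg G g K \<longleftrightarrow> H = K"
  using assms conjg_subset_iff by (metis subset_antisym subset_refl)

text \<open>Shifts a conjugation from the smaller set to the larger one. For coweightings the sum
  runs over the source, so the conjugating element has to act on the target.\<close>

lemma conjg_subset_conjg_inv_iff:
  assumes "g \<in> carrier G" "H \<subseteq> carrier G" "K \<subseteq> carrier G"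
  shows "conjg G g H \<subseteq> K \<longleftrightarrow> H \<subseteq> conjg G (inv g) K"
  using conjg_subset_iff[OF assms(1,2) conjg_subset_carrier[OF inv_closed[OF assms(1)] assms(3)]]
  by (simp add: assms conjg_inv_conjg)

lemma conjg_Int:
  assumes "g \<in> carrier G" "H \<subseteq> carrier G" "K \<subseteq> carrier G"
  shows "conjg G g (H \<inter> K) = conjg G g H \<inter> conjg G g K"
  unfolding conjg_eq_image by (rule inj_on_image_Int[OF inj_on_conj]) (use assms in auto)

lemma subgroup_conjg:
  assumes "g \<in> carrier G" "subgroup H G"
  shows "subgroup (conjg G g H) G"
proof -
  have "(\<lambda>h. inv g \<otimes> h \<otimes> g) \<in> hom G G"
    using assms(1) by (auto simp: hom_def m_assoc mult_inv_cancel_left)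
  then have "group_hom G G (\<lambda>h. inv g \<otimes> h \<otimes> g)"
    by unfold_locales
  then show ?thesis
    unfolding conjg_eq_image by (rule group_hom.subgroup_img_is_subgroup[OF _ assms(2)])
qed

section \<open>Centralizers and objects under conjugation\<close>

lemma centralizer_subset_carrier: "centralizer G H \<subseteq> carrier G"
  by (auto simp: centralizer_def)

lemma centralizer_antimono: "H \<subseteq> K \<Longrightarrow> centralizer G K \<subseteq> centralizer G H"
  by (auto simp: centralizer_def)

lemma subgroup_centralizer:
  assumes "H \<subseteq> carrier G"
  shows "subgroup (centralizer G H) G"
proof (rule subgroupI)
  show "centralizer G H \<noteq> {}"
    using assms by (auto simp: centralizer_def intro!: exI[of _ \<one>])
next
  fix a assume a: "a \<in> centralizer G H"
  have "inv a \<otimes> h = h \<otimes> inv a" if "h \<in> H" for h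
  proof -
    have h: "h \<in> carrier G" and aG: "a \<in> carrier G" using that assms a by (auto simp: centralizer_def)
    have "a \<otimes> h = h \<otimes> a" using a that by (auto simp: centralizer_def)
    then have "h = inv a \<otimes> (h \<otimes> a)" using h aG by (metis inv_solve_left m_closed)
    then show ?thesis using h aG by (metis inv_closed inv_solve_right m_assoc m_closed)
  qed
  then show "inv a \<in> centralizer G H" using a by (auto simp: centralizer_def)
next
  fix a b assume "a \<in> centralizer G H" "b \<in> centralizer G H"
  then show "a \<otimes> b \<in> centralizer G H"
    using assms unfolding centralizer_def by (auto simp: subset_iff) (metis m_assoc)
qed (rule centralizer_subset_carrier)

lemma conjg_centralizer_subset:
  assumes "g \<in> carrier G" "H \<subseteq> carrier G"
  shows "conjg G g (centralizer G H) \<subseteq> centralizer G (conjg G g H)"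
proof
  fix x assume "x \<in> conjg G g (centralizer G H)"
  then obtain c where c: "c \<in> carrier G" "\<And>h. h \<in> H \<Longrightarrow> c \<otimes> h = h \<otimes> c" and x: "x = inv g \<otimes> c \<otimes> g"
    by (auto simp: conjg_eq_image centralizer_def)
  have *: "inv g \<otimes> a \<otimes> g \<otimes> (inv g \<otimes> b \<otimes> g) = inv g \<otimes> (a \<otimes> b) \<otimes> g"
    if "a \<in> carrier G" "b \<in> carrier G" for a b
    using that assms(1) by (simp add: m_assoc mult_inv_cancel_left)
  show "x \<in> centralizer G (conjg G g H)"
    using assms c x by (auto simp: centralizer_def conjg_eq_image * subset_iff)
qed

lemma centralizer_conjg:
  assumes "g \<in> carrier G" "H \<subseteq> carrier G"
  shows "centralizer G (conjg G g H) = conjg G g (centralizer G H)"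
proof (rule subset_antisym)
  \<comment> \<open>The reverse inclusion is the forward one for \<open>inv g\<close> and the
    conjugate of \<open>H\<close>, conjugated back.\<close>
  have "conjg G (inv g) (centralizer G (conjg G g H)) \<subseteq> centralizer G H"
    using conjg_centralizer_subset[of "inv g" "conjg G g H"] assms
    by (simp add: conjg_inv_conjg conjg_subset_carrier)
  then show "centralizer G (conjg G g H) \<subseteq> conjg G g (centralizer G H)"
    using conjg_subset_conjg_inv_iff[of "inv g" "centralizer G (conjg G g H)" "centralizer G H"] assms
    by (simp add: centralizer_subset_carrier)
qed (rule conjg_centralizer_subset[OF assms])

lemma card_centralizer_conjg:
  "g \<in> carrier G \<Longrightarrow> H \<subseteq> carrier G \<Longrightarrow> card (centralizer G (conjg G g H)) = card (centralizer G H)"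
  by (simp add: centralizer_conjg card_conjg centralizer_subset_carrier)

lemma p_subgroup_conjg:
  "g \<in> carrier G \<Longrightarrow> p_subgroup G p H \<Longrightarrow> p_subgroup G p (conjg G g H)"
  by (auto simp: p_subgroup_def subgroup_conjg card_conjg subgroup.subset)

text \<open>An inner automorphism carries centralizers to centralizers and preserves orders, so each
  clause of the Sylow condition is transported.\<close>

lemma objs_conjg:
  assumes g: "g \<in> carrier G" and H: "H \<in> objs G p"
  shows "conjg G g H \<in> objs G p"
proof -
  have HG: "H \<subseteq> carrier G" using H by (auto simp: objs_def p_subgroup_def subgroup.subset)
  have eq: "conjg G g H \<inter> centralizer G (conjg G g H) = conjg G g (H \<inter> centralizer G H)"
    using g HG by (simp add: centralizer_conjg conjg_Int centralizer_subset_carrier)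
  have "card (conjg G g (H \<inter> centralizer G H)) = card (H \<inter> centralizer G H)"
    using g HG by (intro card_conjg) auto
  moreover have "conjg G g (H \<inter> centralizer G H) \<subseteq> centralizer G (conjg G g H)"
    using eq by blast
  ultimately show ?thesis
    using assms HG unfolding objs_def p_selfcentralizing_def sylow_of_def mem_Collect_eq eq
    by (simp add: p_subgroup_conjg card_centralizer_conjg)
qed

subsection \<open>Conjugacy classes\<close>

lemma conjclass_refl: "H \<subseteq> carrier G \<Longrightarrow> H \<in> conjclass G H"
  unfolding conjclass_def using conjg_one[of H] one_closed by force

lemma conjclass_eq:
  assumes "H \<subseteq> carrier G" "K \<in> conjclass G H"
  shows "conjclass G K = conjclass G H"
proof -
  obtain g where g: "g \<in> carrier G" and K: "K = conjg G g H"
    using assms by (auto simp: conjclass_def)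
  have "\<exists>h'\<in>carrier G. conjg G h H = conjg G h' K" if "h \<in> carrier G" for h
    using that g assms(1) by (intro bexI[of _ "inv g \<otimes> h"]) (simp_all add: K conjg_conjg m_assoc[symmetric])
  moreover have "\<exists>h'\<in>carrier G. conjg G h K = conjg G h' H" if "h \<in> carrier G" for h
    using that g assms(1) by (intro bexI[of _ "g \<otimes> h"]) (simp_all add: K conjg_conjg)
  ultimately show ?thesis unfolding conjclass_def by blast
qed

text \<open>Orbit-stabilizer for the conjugation action on subsets of the carrier; the normalizer is
  the stabilizer.\<close>

lemma card_conjclass:
  assumes "H \<subseteq> carrier G"
  shows "card (conjclass G H) * card (normalizer G H) = card (carrier G)"
proof -
  define \<phi> where "\<phi> = (\<lambda>g. \<lambda>H \<in> {H. H \<subseteq> carrier G}. (g <# H) #> inv g)"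
  interpret group_action G "{H. H \<subseteq> carrier G}" \<phi>
    unfolding \<phi>_def by (rule action_by_conjugation_on_power_set)
  \<comment> \<open>The action is by \<open>g H g^-1\<close>, opposite to \<open>conjg\<close>;
    exchanging \<open>g\<close> and \<open>inv g\<close> leaves the orbit unchanged.\<close>
  have "\<phi> g H = conjg G (inv g) H" if "g \<in> carrier G" for g
    using that assms by (auto simp: \<phi>_def conjg_eq_image l_coset_def r_coset_def)
  then have "orbit G \<phi> H = {conjg G (inv g) H | g. g \<in> carrier G}"
    unfolding orbit_def by auto
  also have "\<dots> = conjclass G H"
    unfolding conjclass_def by (auto intro: exI[of _ "inv _"]) (metis inv_closed inv_inv)
  finally have "orbit G \<phi> H = conjclass G H" .
  then show ?thesis
    using orbit_stabilizer_theorem[of H] assms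
    by (simp add: normalizer_def \<phi>_def order_def)
qed

subsection \<open>Moebius inversion\<close>

lemma mu_refl: "mu G H H = 1"
  by (simp only: mu.simps[of G H H] if_True simp_thms)

lemma mu_not_subset:
  assumes "\<not> H \<subseteq> K"
  shows "mu G H K = 0"
proof -
  have "H \<noteq> K" "\<not> (H \<subset> K \<and> finite K)" using assms by blast+
  then show ?thesis by (simp only: mu.simps[of G H K] if_False)
qed

lemma finite_subgroups: "finite K \<Longrightarrow> finite {L. subgroup L G \<and> H \<subseteq> L \<and> L \<subseteq> K}"
  by (rule finite_subset[of _ "Pow K"]) auto

text \<open>For \<open>H\<close> strictly below \<open>K\<close> this is the defining recursion with
  the summand \<open>L = K\<close> brought to the other side.\<close>

lemma sum_mu_upper:
  assumes "finite K" "subgroup H G" "subgroup K G" "H \<subseteq> K"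
  shows "(\<Sum>L \<in> {L. subgroup L G \<and> H \<subseteq> L \<and> L \<subseteq> K}. mu G H L) = (if H = K then 1 else 0)"
proof (cases "H = K")
  case True
  then have "{L. subgroup L G \<and> H \<subseteq> L \<and> L \<subseteq> K} = {K}" using assms by auto
  then show ?thesis using True by (simp add: mu_refl)
next
  case False
  have "{L. subgroup L G \<and> H \<subseteq> L \<and> L \<subseteq> K} = insert K {L. subgroup L G \<and> H \<subseteq> L \<and> L \<subset> K}"
    using assms by auto
  moreover have "finite {L. subgroup L G \<and> H \<subseteq> L \<and> L \<subset> K}"
    by (rule finite_subset[OF _ finite_subgroups[OF assms(1), of H]]) auto
  moreover have "mu G H K = - (\<Sum>L \<in> {L. subgroup L G \<and> H \<subseteq> L \<and> L \<subset> K}. mu G H L)"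
  proof -
    have "H \<subset> K \<and> finite K" using False assms by blast
    then show ?thesis using False by (simp only: mu.simps[of G H K] if_False if_True simp_thms)
  qed
  ultimately show ?thesis using False by simp
qed

text \<open>A left inverse of the incidence matrix is also a right inverse: evaluating
  \<open>\<Sum>\<^sub>M \<mu>(H,M) \<Sum>\<^sub>L\<^sub>\<ge>\<^sub>M \<mu>(L,K)\<close> in both orders isolates the summand at \<open>M = H\<close>.\<close>
lemma sum_mu_lower:
  assumes "finite K" "subgroup H G" "subgroup K G" "H \<subseteq> K"
  shows "(\<Sum>L \<in> {L. subgroup L G \<and> H \<subseteq> L \<and> L \<subseteq> K}. mu G L K) = (if H = K then 1 else 0)"
  using assms
proof (induction "card K - card H" arbitrary: H rule: less_induct)
  case less
  define I where "I A B = {L. subgroup L G \<and> A \<subseteq> L \<and> L \<subseteq> B}" for A B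
  define D where "D M = (\<Sum>L \<in> I M K. mu G L K)" for M
  have finI: "finite (I A B)" if "B \<subseteq> K" for A B
    unfolding I_def using finite_subgroups finite_subset[OF that less.prems(1)] .
  show ?case
  proof (cases "H = K")
    case True
    then have "I H K = {K}" using less.prems by (auto simp: I_def)
    then show ?thesis using True by (simp add: mu_refl flip: I_def)
  next
    case False
    \<comment> \<open>Above \<open>H\<close> the interval up to \<open>K\<close> is shorter, so the
      induction hypothesis evaluates \<open>D M\<close>; only \<open>D H\<close> stays
      unknown.\<close>
    have D: "D M = (if M = K then 1 else 0)" if "M \<in> I H K - {H}" for M
    proof -
      have M: "subgroup M G" "H \<subset> M" "M \<subseteq> K" using that by (auto simp: I_def)
      then have "card H < card M" "card M \<le> card K"
        using less.prems(1) by (meson finite_subset psubset_card_mono card_mono)+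
      then show ?thesis
        unfolding D_def I_def using less.hyps[of M] less.prems M by auto
    qed
    have HI: "H \<in> I H K" and KI: "K \<in> I H K - {H}" using less.prems False by (auto simp: I_def)
    have "(\<Sum>M \<in> I H K. mu G H M * D M) = (\<Sum>M \<in> I H K. \<Sum>L \<in> {L \<in> I H K. M \<subseteq> L}. mu G H M * mu G L K)"
      unfolding D_def sum_distrib_left by (intro sum.cong) (auto simp: I_def)
    also have "\<dots> = (\<Sum>L \<in> I H K. \<Sum>M \<in> {M \<in> I H K. M \<subseteq> L}. mu G H M * mu G L K)"
      by (rule sum.swap_restrict) (auto simp: finI)
    also have "\<dots> = (\<Sum>L \<in> I H K. (\<Sum>M \<in> I H L. mu G H M) * mu G L K)"
      unfolding sum_distrib_right by (intro sum.cong) (auto simp: I_def)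
    also have "\<dots> = (\<Sum>L \<in> I H K. (if L = H then mu G L K else 0))"
    proof (rule sum.cong[OF refl])
      fix L assume "L \<in> I H K"
      then have "(\<Sum>M \<in> I H L. mu G H M) = (if H = L then 1 else 0)"
        unfolding I_def using less.prems by (intro sum_mu_upper) (auto intro: finite_subset)
      then show "(\<Sum>M \<in> I H L. mu G H M) * mu G L K = (if L = H then mu G L K else 0)" by auto
    qed
    also have "\<dots> = mu G H K" using HI finI[of K H] by simp
    finally have 1: "(\<Sum>M \<in> I H K. mu G H M * D M) = mu G H K" .
    have "(\<Sum>M \<in> I H K. mu G H M * D M) = mu G H H * D H + (\<Sum>M \<in> I H K - {H}. mu G H M * D M)"
      using HI finI[of K H] by (simp add: sum.remove)
    also have "(\<Sum>M \<in> I H K - {H}. mu G H M * D M) = (\<Sum>M \<in> I H K - {H}. if M = K then mu G H M else 0)"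
      by (intro sum.cong) (auto simp: D)
    also have "\<dots> = mu G H K" using KI finI[of K H] by simp
    \<comment> \<open>Both evaluations contain \<open>mu G H K\<close>, which cancels and leaves
      \<open>mu G H H * D H = 0\<close>.\<close>
    finally have "D H = 0" using 1 by (simp add: mu_refl)
    then show ?thesis using False by (simp add: D_def I_def)
  qed
qed

text \<open>Conjugation by \<open>g\<close> is an automorphism of the subgroup lattice, so it maps
  the index set of the recursion for \<open>H\<close> and \<open>K\<close> onto that for their
  conjugates. Induction over proper subsets of \<open>K\<close> matches the summands.\<close>

lemma mu_conjg:
  assumes g: "g \<in> carrier G" and "H \<subseteq> carrier G" "K \<subseteq> carrier G" "finite K"
  shows "mu G (conjg G g H) (conjg G g K) = mu G H K"
  using assms(4,3)
proof (induction K rule: finite_psubset_induct)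
  case (psubset K)
  let ?A = "{L. subgroup L G \<and> H \<subseteq> L \<and> L \<subset> K}"
  let ?B = "{L. subgroup L G \<and> conjg G g H \<subseteq> L \<and> L \<subset> conjg G g K}"
  have ps: "conjg G g A \<subset> conjg G g B \<longleftrightarrow> A \<subset> B" if "A \<subseteq> carrier G" "B \<subseteq> carrier G" for A B
    using that by (simp add: psubset_eq conjg_subset_iff[OF g] conjg_eq_iff[OF g])
  have inj: "inj_on (conjg G g) ?A"
    by (rule inj_onI) (simp add: conjg_eq_iff[OF g] subgroup.subset)
  have "?B = conjg G g ` ?A"
  proof
    show "conjg G g ` ?A \<subseteq> ?B"
    proof (intro image_subsetI CollectI conjI)
      fix L assume L: "L \<in> ?A"
      show "subgroup (conjg G g L) G" using L g by (simp add: subgroup_conjg)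
      show "conjg G g H \<subseteq> conjg G g L" using L by (simp add: conjg_mono)
      show "conjg G g L \<subset> conjg G g K" using L psubset.prems by (simp add: ps subgroup.subset)
    qed
    show "?B \<subseteq> conjg G g ` ?A"
    proof
      fix L assume L: "L \<in> ?B"
      then have LG: "L \<subseteq> carrier G" by (auto simp: subgroup.subset)
      define M where "M = conjg G (inv g) L"
      have M: "subgroup M G" "conjg G g M = L"
        using L LG g by (auto simp: M_def subgroup_conjg conjg_inv_conjg)
      then have "H \<subseteq> M" "M \<subset> K"
        using L ps[of M K] conjg_subset_iff[OF g assms(2), of M] psubset.prems subgroup.subset[of M G]
        by simp_all
      then show "L \<in> conjg G g ` ?A" using M by blast
    qed
  qed
  then have "(\<Sum>L\<in>?B. mu G (conjg G g H) L) = (\<Sum>L\<in>?A. mu G (conjg G g H) (conjg G g L))"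
    using inj by (simp add: sum.reindex)
  also have "\<dots> = (\<Sum>L\<in>?A. mu G H L)"
    by (intro sum.cong refl psubset.IH) (simp_all add: subgroup.subset)
  finally have "(\<Sum>L\<in>?B. mu G (conjg G g H) L) = (\<Sum>L\<in>?A. mu G H L)" .
  moreover have "finite (conjg G g K)" using psubset.hyps by (simp add: conjg_eq_image)
  ultimately show ?case
    using psubset.hyps psubset.prems assms(2)
    by (simp add: mu.simps[of G "conjg G g H" "conjg G g K"] mu.simps[of G H K] ps conjg_eq_iff[OF g])
qed

subsection \<open>Double cosets\<close>

lemma mem_dcoset_iff: "y \<in> (A #> g) <#> B \<longleftrightarrow> (\<exists>a\<in>A. \<exists>b\<in>B. y = a \<otimes> g \<otimes> b)"
  by (auto simp: set_mult_def r_coset_def)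

text \<open>The map \<open>(a, b)\<close> to \<open>a g b\<close> is onto the double coset, and each
  of its fibres is in bijection with the intersection of \<open>B\<close> with the conjugate of
  \<open>A\<close>.\<close>

lemma card_dcoset:
  assumes A: "subgroup A G" and B: "subgroup B G" and g: "g \<in> carrier G"
    and fin: "finite A" "finite B"
  shows "card ((A #> g) <#> B) * card (conjg G g A \<inter> B) = card A * card B"
proof -
  define f where "f = (\<lambda>(a,b). a \<otimes> g \<otimes> b)"
  define D where "D = conjg G g A \<inter> B"
  have AG: "\<And>a. a \<in> A \<Longrightarrow> a \<in> carrier G" and BG: "\<And>b. b \<in> B \<Longrightarrow> b \<in> carrier G"
    using A B subgroup.mem_carrier by metis+
  have im: "f ` (A \<times> B) = (A #> g) <#> B"
    by (force simp: f_def mem_dcoset_iff image_iff)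
  have fibre: "card {x \<in> A \<times> B. f x = y} = card D" if y: "y \<in> f ` (A \<times> B)" for y
  proof -
    obtain a0 b0 where ab0: "a0 \<in> A" "b0 \<in> B" "y = a0 \<otimes> g \<otimes> b0" using y by (auto simp: f_def)
    note c = AG[OF ab0(1)] BG[OF ab0(2)] g
    \<comment> \<open>An element \<open>x\<close> of \<open>D\<close> can be passed between the
      factors: \<open>x^-1\<close> enters on the left of \<open>b0\<close>, and
      \<open>g x g^-1\<close>, which lies in \<open>A\<close>, is absorbed by
      \<open>a0\<close>.\<close>
    let ?h = "\<lambda>x. (a0 \<otimes> (g \<otimes> x \<otimes> inv g), inv x \<otimes> b0)"
    have "bij_betw ?h D {x \<in> A \<times> B. f x = y}"
    proof (rule bij_betw_imageI)
      show "inj_on ?h D"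
        using c BG by (auto simp: inj_on_def D_def)
      show "?h ` D = {x \<in> A \<times> B. f x = y}"
      proof (intro subset_antisym subsetI)
        fix u assume "u \<in> ?h ` D"
        then obtain x where x: "x \<in> D" "u = ?h x" by auto
        then obtain a where a: "a \<in> A" "x = inv g \<otimes> a \<otimes> g" by (auto simp: D_def conjg_eq_image)
        have "g \<otimes> x \<otimes> inv g = a"
          using a c AG[OF a(1)] by (simp add: m_assoc mult_inv_cancel_left)
        moreover have "f u = y"
          using x c BG by (auto simp: D_def f_def ab0(3) m_assoc mult_inv_cancel_left)
        ultimately show "u \<in> {x \<in> A \<times> B. f x = y}"
          using x a ab0 A B by (auto simp: D_def intro: subgroup.m_closed subgroup.m_inv_closed)
      next
        fix u assume u: "u \<in> {x \<in> A \<times> B. f x = y}"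
        obtain a b where ab: "u = (a,b)" "a \<in> A" "b \<in> B" "a \<otimes> g \<otimes> b = a0 \<otimes> g \<otimes> b0"
          using u by (cases u) (auto simp: f_def ab0(3))
        note c' = AG[OF ab(2)] BG[OF ab(3)] c
        \<comment> \<open>The second coordinate of \<open>?h\<close> forces this choice. Solving
          \<open>a g b = a0 g b0\<close> for \<open>b0\<close> then shows that \<open>x\<close> also
          lies in the conjugate of \<open>A\<close>.\<close>
        define x where "x = b0 \<otimes> inv b"
        have "b0 = inv g \<otimes> (inv a0 \<otimes> (a0 \<otimes> g \<otimes> b0))"
          using c' by (simp add: m_assoc mult_inv_cancel_left)
        also have "\<dots> = inv g \<otimes> (inv a0 \<otimes> (a \<otimes> g \<otimes> b))" by (simp only: ab(4))
        finally have b0: "b0 = inv g \<otimes> (inv a0 \<otimes> (a \<otimes> g \<otimes> b))" .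
        have x: "x = inv g \<otimes> (inv a0 \<otimes> a) \<otimes> g"
          unfolding x_def by (subst b0) (use c' in \<open>simp add: m_assoc\<close>)
        have "inv a0 \<otimes> a \<in> A" "x \<in> B"
          using A B ab ab0 by (simp_all add: x_def subgroup.m_closed subgroup.m_inv_closed)
        then have "x \<in> D" using x by (auto simp: D_def conjg_eq_image)
        moreover have "u = ?h x"
        proof -
          have "a0 \<otimes> (g \<otimes> x \<otimes> inv g) = a"
            using c' by (simp add: x m_assoc mult_inv_cancel_left)
          moreover have "inv x \<otimes> b0 = b"
            using c' by (simp add: x_def inv_mult_group m_assoc)
          ultimately show ?thesis using ab(1) by simp
        qed
        ultimately show "u \<in> ?h ` D" by blast
      qed
    qed
    then show ?thesis by (simp add: bij_betw_same_card)
  qed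
  have "card A * card B = (\<Sum>x \<in> A \<times> B. 1)" by (simp add: card_cartesian_product)
  also have "\<dots> = (\<Sum>y \<in> f ` (A \<times> B). \<Sum>x \<in> {x \<in> A \<times> B. f x = y}. 1)"
    using fin by (intro sum.image_gen) simp
  also have "\<dots> = (\<Sum>y \<in> f ` (A \<times> B). card D)"
    by (intro sum.cong refl) (simp add: fibre)
  finally show ?thesis by (simp add: im D_def)
qed

lemma dcoset_self:
  assumes "subgroup A G" "subgroup B G" "g \<in> carrier G"
  shows "g \<in> (A #> g) <#> B"
  unfolding mem_dcoset_iff
  by (rule bexI[of _ \<one>], rule bexI[of _ \<one>]) (simp_all add: assms subgroup.one_closed)

lemma dcoset_subset:
  assumes "subgroup A G" "subgroup B G" "g \<in> carrier G" "y \<in> (A #> g) <#> B"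
  shows "(A #> y) <#> B \<subseteq> (A #> g) <#> B"
proof
  fix x assume "x \<in> (A #> y) <#> B"
  then obtain a b a' b' where ab: "a \<in> A" "b \<in> B" "a' \<in> A" "b' \<in> B"
    "x = a' \<otimes> (a \<otimes> g \<otimes> b) \<otimes> b'"
    using assms(4) by (auto simp: mem_dcoset_iff)
  then have "x = (a' \<otimes> a) \<otimes> g \<otimes> (b \<otimes> b')"
    using assms(1-3) by (simp add: m_assoc subgroup.mem_carrier)
  moreover have "a' \<otimes> a \<in> A" "b \<otimes> b' \<in> B" using ab assms(1,2) by (simp_all add: subgroup.m_closed)
  ultimately show "x \<in> (A #> g) <#> B" unfolding mem_dcoset_iff by blast
qed

lemma dcoset_eq:
  assumes A: "subgroup A G" and B: "subgroup B G" and g: "g \<in> carrier G"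
    and y: "y \<in> (A #> g) <#> B"
  shows "(A #> y) <#> B = (A #> g) <#> B"
proof (rule subset_antisym[OF dcoset_subset[OF assms]])
  obtain a b where ab: "a \<in> A" "b \<in> B" "y = a \<otimes> g \<otimes> b" using y by (auto simp: mem_dcoset_iff)
  then have c: "a \<in> carrier G" "b \<in> carrier G" "y \<in> carrier G"
    using A B g by (auto simp: subgroup.mem_carrier)
  have "g = inv a \<otimes> y \<otimes> inv b" using c g ab by (simp add: m_assoc mult_inv_cancel_left)
  moreover have "inv a \<in> A" "inv b \<in> B" using ab A B by (simp_all add: subgroup.m_inv_closed)
  ultimately have "g \<in> (A #> y) <#> B" unfolding mem_dcoset_iff by blast
  then show "(A #> g) <#> B \<subseteq> (A #> y) <#> B" using A B c by (intro dcoset_subset)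
qed

text \<open>A set closed under forming double cosets is partitioned by them; equal sizes turn the
  count of \<open>T\<close> into a product.\<close>

lemma card_dcosets:
  assumes A: "subgroup A G" and B: "subgroup B G" and T: "finite T" "T \<subseteq> carrier G"
    and closed: "\<And>g. g \<in> T \<Longrightarrow> (A #> g) <#> B \<subseteq> T"
    and card: "\<And>g. g \<in> T \<Longrightarrow> card ((A #> g) <#> B) = s"
  shows "card ((\<lambda>g. (A #> g) <#> B) ` T) * s = card T"
proof -
  let ?C = "(\<lambda>g. (A #> g) <#> B) ` T"
  have U: "\<Union>?C = T"
  proof
    show "\<Union>?C \<subseteq> T" using closed by (rule UN_least)
    show "T \<subseteq> \<Union>?C" using dcoset_self[OF A B] T(2) by (auto intro!: bexI)
  qed
  have "s * card ?C = card (\<Union>?C)"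
  proof (rule card_partition)
    show "finite ?C" "finite (\<Union>?C)" using T U by simp_all
    show "\<And>c. c \<in> ?C \<Longrightarrow> card c = s" using card by auto
    fix c1 c2 assume c: "c1 \<in> ?C" "c2 \<in> ?C" "c1 \<noteq> c2"
    then obtain g1 g2 where g: "g1 \<in> carrier G" "g2 \<in> carrier G"
      "c1 = (A #> g1) <#> B" "c2 = (A #> g2) <#> B" using T by blast
    show "c1 \<inter> c2 = {}"
    proof (rule ccontr)
      assume "c1 \<inter> c2 \<noteq> {}"
      then obtain y where "y \<in> c1" "y \<in> c2" by blast
      then have "c1 = c2" using g dcoset_eq[OF A B, of g1 y] dcoset_eq[OF A B, of g2 y] by simp
      then show False using c by simp
    qed
  qed
  then show ?thesis using U by (simp add: mult.commute)
qed

subsection \<open>Central Sylow subgroups\<close>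

lemma card_subgroup_dvd:
  assumes "subgroup A G" "subgroup B G" "A \<subseteq> B"
  shows "card A dvd card B"
proof -
  have "group (G\<lparr>carrier := B\<rparr>)" using assms(2) by (rule subgroup_imp_group)
  from group.lagrange[OF this subgroup_incl[OF assms]]
  have "card (rcosets\<^bsub>G\<lparr>carrier := B\<rparr>\<^esub> A) * card A = card B" by (simp add: order_def)
  then show ?thesis using dvd_triv_right by metis
qed

text \<open>The complement is the kernel of the transfer into \<open>Z\<close>, which on \<open>Z\<close> itself is
  the bijection raising to the power of the index.\<close>
lemma central_Hall_complement:
  assumes fin: "finite (carrier G)" and Z: "subgroup Z G"
    and central: "\<And>z g. z \<in> Z \<Longrightarrow> g \<in> carrier G \<Longrightarrow> z \<otimes> g = g \<otimes> z"
    and cop: "coprime (card (rcosets Z)) (card Z)"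
  shows "\<exists>N. N \<lhd> G \<and> card N * card Z = card (carrier G)"
proof -
  let ?A = "G\<lparr>carrier := Z\<rparr>"
  have ZG: "Z \<subseteq> carrier G" using Z by (rule subgroup.subset)
  interpret A: comm_group ?A
    by (rule group.group_comm_groupI[OF subgroup_imp_group[OF Z]]) (use central ZG in auto)
  define R where "R = rcosets Z"
  have Rfin: "finite R" unfolding R_def RCOSETS_def using fin by simp
  \<comment> \<open>The elements \<open>t Q\<close> form a transversal of the right cosets of
    \<open>Z\<close>.\<close>
  define t where "t Q = (SOME x. x \<in> Q)" for Q :: "'a set"
  have tQ: "t Q \<in> carrier G" "Z #> t Q = Q" if Q: "Q \<in> R" for Q
  proof -
    obtain x where x: "x \<in> carrier G" "Q = Z #> x" using Q by (auto simp: R_def RCOSETS_def)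
    have "x \<in> Q" using x rcos_self[OF x(1) Z] by simp
    then have "t Q \<in> Q" unfolding t_def by (rule someI)
    then show "t Q \<in> carrier G" using x r_coset_subset_G[OF ZG x(1)] by blast
    show "Z #> t Q = Q" using repr_independence[OF _ x(1) Z, of "t Q"] x \<open>t Q \<in> Q\<close> by simp
  qed
  have act: "Q #> g = Z #> (t Q \<otimes> g)" if "Q \<in> R" "g \<in> carrier G" for Q g
    using coset_mult_assoc[OF ZG tQ(1)[OF that(1)] that(2)] tQ(2)[OF that(1)] by simp
  have RG: "Q #> g \<in> R" if "Q \<in> R" "g \<in> carrier G" for Q g
    using act[OF that] tQ that ZG by (simp add: R_def rcosetsI)
  \<comment> \<open>The correction in \<open>Z\<close> between \<open>t Q \<otimes> g\<close> and
    the chosen representative of its coset; the transfer is the product of these over all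
    cosets.\<close>
  define f where "f Q g = t Q \<otimes> g \<otimes> inv (t (Q #> g))" for Q g
  have fZ: "f Q g \<in> Z" if "Q \<in> R" "g \<in> carrier G" for Q g
  proof -
    have c: "t Q \<otimes> g \<in> carrier G" "t (Q #> g) \<in> carrier G" using tQ RG that by auto
    have "t Q \<otimes> g \<in> Z #> (t Q \<otimes> g)" using c by (intro rcos_self Z)
    then have "t Q \<otimes> g \<in> Z #> t (Q #> g)" using act[OF that] tQ(2)[OF RG[OF that]] by simp
    then show ?thesis
      unfolding f_def using subgroup.rcos_module_imp[OF Z is_group c(2)] by simp
  qed
  define \<tau> where "\<tau> g = finprod ?A (\<lambda>Q. f Q g) R" for g
  have hom: "\<tau> \<in> hom G ?A"
  proof (rule homI)
    fix g assume "g \<in> carrier G"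
    then show "\<tau> g \<in> carrier ?A" unfolding \<tau>_def using fZ by (intro A.finprod_closed) auto
  next
    fix g h assume g: "g \<in> carrier G" and h: "h \<in> carrier G"
    have RsubG: "Q \<subseteq> carrier G" if "Q \<in> R" for Q
      using that ZG tQ r_coset_subset_G by metis
    have assoc: "(Q #> g) #> h = Q #> (g \<otimes> h)" if "Q \<in> R" for Q
      using coset_mult_assoc[OF RsubG[OF that] g h] .
    \<comment> \<open>Cocycle identity. Multiplicativity of the transfer follows by reindexing the
      second factor along the permutation \<open>Q\<close> to \<open>Q #> g\<close> of the
      cosets.\<close>
    have split: "f Q (g \<otimes> h) = f Q g \<otimes>\<^bsub>?A\<^esub> f (Q #> g) h" if Q: "Q \<in> R" for Q
      using tQ(1)[OF Q] tQ(1)[OF RG[OF Q g]] tQ(1)[OF RG[OF RG[OF Q g] h]] g h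
      by (simp add: f_def assoc[OF Q] m_assoc mult_inv_cancel_left)
    have inj: "inj_on (\<lambda>Q. Q #> g) R"
    proof (rule inj_onI)
      fix Q Y assume XY: "Q \<in> R" "Y \<in> R" "Q #> g = Y #> g"
      then have "(Q #> g) #> inv g = (Y #> g) #> inv g" by simp
      then show "Q = Y"
        using coset_mult_assoc[OF RsubG g inv_closed[OF g]] XY(1,2) g RsubG by simp
    qed
    have onto: "(\<lambda>Q. Q #> g) ` R = R"
      using endo_inj_surj[OF Rfin _ inj] RG g by blast
    have "\<tau> (g \<otimes> h) = finprod ?A (\<lambda>Q. f Q g \<otimes>\<^bsub>?A\<^esub> f (Q #> g) h) R"
      unfolding \<tau>_def
      by (rule A.finprod_cong') (use split fZ RG g h Z in \<open>auto intro: subgroup.m_closed\<close>)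
    also have "\<dots> = finprod ?A (\<lambda>Q. f Q g) R \<otimes>\<^bsub>?A\<^esub> finprod ?A (\<lambda>Q. f (Q #> g) h) R"
      by (rule A.finprod_multf) (use fZ RG g h in auto)
    also have "finprod ?A (\<lambda>Q. f (Q #> g) h) R = finprod ?A (\<lambda>Q. f Q h) ((\<lambda>Q. Q #> g) ` R)"
      by (rule A.finprod_reindex[symmetric, OF _ inj]) (use fZ RG g h in auto)
    finally show "\<tau> (g \<otimes> h) = \<tau> g \<otimes>\<^bsub>?A\<^esub> \<tau> h" by (simp add: \<tau>_def onto)
  qed
  have \<tau>Z: "\<tau> z = z [^]\<^bsub>?A\<^esub> card R" if z: "z \<in> Z" for z
  proof -
    have zG: "z \<in> carrier G" using z ZG by blast
    \<comment> \<open>A central \<open>z\<close> fixes every coset, because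
      \<open>Z (t Q) z = Z z (t Q) = Q\<close>; hence every factor of the transfer is
      \<open>z\<close>.\<close>
    have "f Q z = z" if Q: "Q \<in> R" for Q
    proof -
      have "Q #> z = Z #> (z \<otimes> t Q)" using act[OF Q zG] central[OF z tQ(1)[OF Q]] by simp
      also have "\<dots> = (Z #> z) #> t Q" using coset_mult_assoc[OF ZG zG tQ(1)[OF Q]] by simp
      also have "\<dots> = Q" using coset_join2[OF zG Z z] tQ(2)[OF Q] by simp
      finally show ?thesis
        unfolding f_def using central[OF z tQ(1)[OF Q], symmetric] tQ(1)[OF Q] zG
        by (simp add: m_assoc)
    qed
    then have "\<tau> z = finprod ?A (\<lambda>Q. z) R"
      unfolding \<tau>_def using z by (intro A.finprod_cong') auto
    then show ?thesis using A.finprod_const[of z R] z by simp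
  qed
  interpret \<tau>: group_hom G ?A \<tau> by unfold_locales (rule hom)
  have "\<exists>g \<in> carrier G. \<tau> g = z" if z: "z \<in> Z" for z
  proof -
    have "card R \<noteq> 0" using Rfin subgroup.subgroup_in_rcosets[OF Z is_group] by (auto simp: R_def)
    \<comment> \<open>By coprimality \<open>x\<close> inverts the index modulo
      \<open>card Z\<close>, so the transfer sends the \<open>x\<close>-th power of \<open>z\<close>
      to \<open>z\<close>.\<close>
    then obtain x y where xy: "card R * x = card Z * y + 1"
      using bezout_nat[of "card R" "card Z"] cop by (auto simp: R_def)
    have "\<tau> (z [^]\<^bsub>?A\<^esub> x) = (z [^]\<^bsub>?A\<^esub> x) [^]\<^bsub>?A\<^esub> card R"
      using \<tau>Z[of "z [^]\<^bsub>?A\<^esub> x"] A.nat_pow_closed[of z x] z by simp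
    also have "\<dots> = z [^]\<^bsub>?A\<^esub> (card R * x)" using z A.nat_pow_pow[of z x "card R"] by (simp add: mult.commute)
    also have "\<dots> = z [^]\<^bsub>?A\<^esub> (card Z * y + 1)" by (simp only: xy)
    also have "\<dots> = (z [^]\<^bsub>?A\<^esub> order ?A) [^]\<^bsub>?A\<^esub> y \<otimes>\<^bsub>?A\<^esub> z"
      using z by (simp add: A.nat_pow_pow order_def del: A.pow_order_eq_1)
    also have "\<dots> = z" using z A.pow_order_eq_1[of z] A.nat_pow_one[of y] A.l_one[of z] by simp
    finally show ?thesis using A.nat_pow_closed[of z x] z ZG by auto
  qed
  then have onto: "\<tau> ` carrier G = carrier ?A" using \<tau>.hom_closed by (auto simp: image_iff) 
  \<comment> \<open>Since the transfer is onto \<open>Z\<close>, its kernel has index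
    \<open>card Z\<close>.\<close>
  have "card (carrier (G Mod kernel G ?A \<tau>)) = card (carrier ?A)"
    using \<tau>.FactGroup_iso_set[OF onto] by (auto simp: iso_def intro: bij_betw_same_card)
  then have "card (rcosets (kernel G ?A \<tau>)) = card Z" by (simp add: FactGroup_def)
  then have "card (kernel G ?A \<tau>) * card Z = card (carrier G)"
    using lagrange[OF \<tau>.subgroup_kernel] by (simp add: order_def mult.commute)
  then show ?thesis using \<tau>.normal_kernel by blast
qed

text \<open>The quotient by \<open>N\<close> has order \<open>m\<close>, so \<open>m\<close>-th
  powers vanish in it.\<close>

lemma normal_pow_index_mem:
  assumes "N \<lhd> G" "finite (carrier G)" "x \<in> carrier G" "card (carrier G) = m * card N"
  shows "x [^] m \<in> N"
proof -
  interpret N: normal N G by fact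
  have "card N > 0"
    using N.one_closed finite_subset[OF N.subset assms(2)] by (metis card_gt_0_iff empty_iff)
  then have "card (rcosets N) = m"
    using lagrange[OF N.subgroup_axioms] assms(4) by (simp add: order_def)
  then have "(N #> x) [^]\<^bsub>G Mod N\<^esub> m = \<one>\<^bsub>G Mod N\<^esub>"
    using group.pow_order_eq_1[OF N.factorgroup_is_group, of "N #> x"] assms(3)
    by (simp add: order_def FactGroup_def rcosetsI N.subset)
  then have "N #> (x [^] m) = N" using N.FactGroup_pow[OF assms(3)] by simp
  then show ?thesis using coset_join1[OF _ _ N.subgroup_axioms] assms(3) by simp
qed

text \<open>A normal complement \<open>N\<close> of the central Sylow subgroup \<open>Z\<close> has
  a \<open>p\<close>-group quotient and order prime to \<open>p\<close>. Its elements die in every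
  quotient of \<open>p\<close>-power order, so \<open>N\<close> is the least member of the family
  that \<open>Op\<close> intersects.\<close>

lemma card_Op_central_Sylow:
  assumes fin: "finite (carrier G)" and p: "Factorial_Ring.prime p" and S: "subgroup S G"
    and Z: "subgroup Z G" "Z \<subseteq> S" "\<And>z g. z \<in> Z \<Longrightarrow> g \<in> S \<Longrightarrow> z \<otimes> g = g \<otimes> z"
      "card Z = p ^ Factorial_Ring.multiplicity p (card S)"
  shows "card (Op G p S) = p'_part p (card S)" "subgroup (Op G p S) G" "Op G p S \<subseteq> S"
proof -
  let ?M = "G\<lparr>carrier := S\<rparr>"
  interpret M: group ?M using S by (rule subgroup_imp_group)
  have SG: "S \<subseteq> carrier G" and Sfin: "finite S" using subgroup.subset[OF S] fin finite_subset by auto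
  have S0: "card S \<noteq> 0" using Sfin subgroup.one_closed[OF S] by auto
  define k where "k = Factorial_Ring.multiplicity p (card S)"
  have pk: "p ^ k dvd card S" unfolding k_def by (rule multiplicity_dvd)
  have npd: "\<not> p dvd card S div p ^ k"
    unfolding k_def using p S0 by (intro multiplicity_decompose) auto
  have ZM: "subgroup Z ?M" using subgroup_incl[OF Z(1) S Z(2)] .
  have pk0: "p ^ k > 0" using p by (simp add: prime_gt_0_nat)
  have "card (rcosets\<^bsub>?M\<^esub> Z) * p ^ k = card S"
    using M.lagrange[OF ZM] Z(4) by (simp add: order_def k_def)
  then have "card (rcosets\<^bsub>?M\<^esub> Z) = card S div p ^ k" using pk0 by (metis div_mult_self_is_m)
  \<comment> \<open>\<open>Z\<close> carries the full \<open>p\<close>-part of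
    \<open>card S\<close>, so its index is prime to \<open>p\<close> and the complement
    exists.\<close>
  then have "coprime (card (rcosets\<^bsub>?M\<^esub> Z)) (card Z)"
    using npd p Z(4) by (simp add: k_def coprime_commute prime_imp_coprime)
  then obtain N where N: "N \<lhd> ?M" "card N * card Z = card S"
    using M.central_Hall_complement[OF _ ZM] Z(3) Sfin by auto
  have cN: "card N = p'_part p (card S)"
    using N(2) Z(4) pk0 unfolding p'_part_def k_def[symmetric] by (metis div_mult_self_is_m)
  have copN: "coprime (p ^ n) (card N)" for n
    using npd p by (simp add: cN p'_part_def k_def prime_imp_coprime)
  have NM: "subgroup N ?M" using N(1) by (rule normal_imp_subgroup)
  then have NS: "N \<subseteq> S" using subgroup.subset by fastforce
  let ?F = "{N. N \<subseteq> S \<and> N \<lhd> ?M \<and> (\<exists>n. card S = p ^ n * card N)}"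
  have "card S = p ^ k * card N" using N(2) Z(4) by (simp add: k_def mult.commute)
  then have "N \<in> ?F" using N(1) NS by blast
  moreover have "N \<subseteq> N'" if N': "N' \<in> ?F" for N'
  proof
    fix x assume x: "x \<in> N"
    have N'M: "N' \<lhd> ?M" using N' by blast
    obtain n where n: "card S = p ^ n * card N'" using N' by blast
    have xS: "x \<in> carrier ?M" using x NS by auto
    have 1: "x [^]\<^bsub>?M\<^esub> (p ^ n) \<in> N'"
      using M.normal_pow_index_mem[of N' x "p ^ n"] N'M n xS Sfin by simp
    have "x [^]\<^bsub>?M\<lparr>carrier := N\<rparr>\<^esub> card N = \<one>\<^bsub>?M\<^esub>"
      using group.pow_order_eq_1[OF M.subgroup_imp_group[OF NM], of x] x by (simp add: order_def)
    then have 2: "x [^]\<^bsub>?M\<^esub> card N = \<one>\<^bsub>?M\<^esub>"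
      using M.nat_pow_consistent[of x "card N" N] by simp
    have "p ^ n \<noteq> 0" using p by auto
    \<comment> \<open>\<open>u\<close> inverts \<open>p ^ n\<close> modulo \<open>card N\<close>; as
      \<open>card N\<close> kills \<open>x\<close>, this recovers \<open>x\<close> as a power of
      \<open>x^(p^n)\<close>, which lies in \<open>N'\<close>.\<close>
    then obtain u v where uv: "p ^ n * u = card N * v + 1"
      using bezout_nat[of "p ^ n" "card N"] copN[of n] by auto
    have "(x [^]\<^bsub>?M\<^esub> (p ^ n)) [^]\<^bsub>?M\<^esub> u = x [^]\<^bsub>?M\<^esub> (card N * v) \<otimes>\<^bsub>?M\<^esub> x"
      using xS M.nat_pow_pow[OF xS, of "p ^ n" u] by (simp add: uv)
    also have "x [^]\<^bsub>?M\<^esub> (card N * v) = \<one>\<^bsub>?M\<^esub>"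
      using M.nat_pow_pow[OF xS, of "card N" v] 2 M.nat_pow_one[of v] by simp
    also have "\<one>\<^bsub>?M\<^esub> \<otimes>\<^bsub>?M\<^esub> x = x" using xS by (rule M.l_one)
    finally have eq: "(x [^]\<^bsub>?M\<^esub> (p ^ n)) [^]\<^bsub>?M\<^esub> u = x" .
    have "subgroup N' ?M" using N'M by (rule normal_imp_subgroup)
    from subgroup.m_closed[OF this] subgroup.one_closed[OF this]
    have "y [^]\<^bsub>?M\<^esub> (j::nat) \<in> N'" if "y \<in> N'" for y j
      using that by (induction j) (auto simp: nat_pow_def)
    from this[OF 1, of u] show "x \<in> N'" using eq by simp
  qed
  ultimately have eq: "Op G p S = N" unfolding Op_def by blast
  show "card (Op G p S) = p'_part p (card S)" "Op G p S \<subseteq> S" using cN NS by (simp_all add: eq)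
  show "subgroup (Op G p S) G" unfolding eq using incl_subgroup[OF S NM] .
qed

end

subsection \<open>Selfcentralizing subgroups\<close>

locale p_local = group G for G (structure) +
  fixes p :: nat
  assumes fin: "finite (carrier G)" and prime_p: "Factorial_Ring.prime p"
begin

lemma objsD:
  assumes "H \<in> objs G p"
  shows "p_subgroup G p H" "subgroup H G" "H \<subseteq> carrier G"
    "card (H \<inter> centralizer G H) = p ^ Factorial_Ring.multiplicity p (card (centralizer G H))"
  using assms
  by (simp_all add: objs_def p_subgroup_def p_selfcentralizing_def sylow_of_def subgroup.subset)

lemma finite_objs: "finite (objs G p)"
proof (rule finite_subset)
  show "objs G p \<subseteq> Pow (carrier G)" using objsD(3) by blast
  show "finite (Pow (carrier G))" using fin by simp
qed

lemma finite_sub: "subgroup H G \<Longrightarrow> finite H"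
  by (rule finite_subset[OF subgroup.subset fin])

lemma card_sub_pos: "subgroup H G \<Longrightarrow> card H > 0"
  using finite_sub[of H] subgroup.one_closed[of H G] by (auto simp: card_gt_0_iff)

lemma subgroup_of_p_subgroup:
  assumes "subgroup H G" "p_subgroup G p K" "H \<subseteq> K"
  shows "p_subgroup G p H"
proof -
  obtain n where "card K = p ^ n" and K: "subgroup K G" using assms(2) by (auto simp: p_subgroup_def)
  then have "card H dvd p ^ n" using card_subgroup_dvd[OF assms(1) K assms(3)] by simp
  then show ?thesis
    using assms(1) prime_p by (auto simp: p_subgroup_def divides_primepow_nat)
qed

lemma card_centralizer_pos: "H \<subseteq> carrier G \<Longrightarrow> card (centralizer G H) > 0"
  by (intro card_sub_pos subgroup_centralizer)

text \<open>\<open>Z(H)\<close>, being Sylow in \<open>C(H)\<close>, accounts for the whole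
  \<open>p\<close>-part of the order.\<close>

lemma card_centralizer_objs:
  assumes "H \<in> objs G p"
  shows "card (centralizer G H) = p'_part p (card (centralizer G H)) * card (H \<inter> centralizer G H)"
  using objsD(4)[OF assms] by (simp add: p'_part_def multiplicity_dvd)

lemma p'_part_pos: "H \<in> objs G p \<Longrightarrow> p'_part p (card (centralizer G H)) > 0"
  using card_centralizer_objs[of H] card_centralizer_pos[OF objsD(3), of H] 
  by (metis gr_zeroI less_irrefl mult_0)

text \<open>The left side is a \<open>p\<close>-subgroup of \<open>C(H)\<close> containing the Sylow
  subgroup \<open>Z(H)\<close>, so it cannot be larger.\<close>

lemma Int_centralizer_p_overgroup:
  assumes H: "H \<in> objs G p" and K: "p_subgroup G p K" and HK: "H \<subseteq> K"
  shows "K \<inter> centralizer G H = H \<inter> centralizer G H"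
proof (rule card_seteq[symmetric])
  let ?C = "centralizer G H"
  have C: "subgroup ?C G" using objsD(3)[OF H] by (rule subgroup_centralizer)
  have KC: "subgroup (K \<inter> ?C) G" using K C by (simp add: p_subgroup_def subgroups_Inter_pair)
  then obtain j where j: "card (K \<inter> ?C) = p ^ j"
    using subgroup_of_p_subgroup[OF KC K] by (auto simp: p_subgroup_def)
  have "p ^ j dvd card ?C" using card_subgroup_dvd[OF KC C] j by simp
  then have "j \<le> Factorial_Ring.multiplicity p (card ?C)"
    using card_sub_pos[OF C] prime_p by (intro multiplicity_geI) (auto simp: not_prime_unit)
  then have "p ^ j \<le> p ^ Factorial_Ring.multiplicity p (card ?C)"
    using prime_gt_0_nat[OF prime_p] by (intro power_increasing) auto
  then show "card (K \<inter> ?C) \<le> card (H \<inter> ?C)" using j objsD(4)[OF H] by simp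
  show "finite (K \<inter> ?C)" using KC by (rule finite_sub)
  show "H \<inter> ?C \<subseteq> K \<inter> ?C" using HK by blast
qed

lemma conjg_centralized:
  assumes "g \<in> centralizer G H" "A \<subseteq> H" "H \<subseteq> carrier G"
  shows "conjg G g A = A"
proof -
  have "inv g \<otimes> h \<otimes> g = h" if "h \<in> A" for h
  proof -
    have g: "g \<in> carrier G" and h: "h \<in> carrier G" and gh: "g \<otimes> h = h \<otimes> g"
      using assms that by (auto simp: centralizer_def)
    show ?thesis using g h by (simp add: m_assoc mult_inv_cancel_left flip: gh)
  qed
  then show ?thesis by (simp add: conjg_eq_image)
qed

text \<open>\<open>Z(K) = Z(H) \<inter> C(K)\<close>, and its index in \<open>C(K)\<close> divides the prime-to-\<open>p\<close> index of
  \<open>Z(H)\<close> in \<open>C(H)\<close>.\<close>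
lemma objs_p_overgroup:
  assumes H: "H \<in> objs G p" and K: "p_subgroup G p K" and HK: "H \<subseteq> K"
  shows "K \<in> objs G p"
proof -
  define C where "C = centralizer G H"
  define D where "D = centralizer G K"
  define Z where "Z = H \<inter> C"
  note HG = objsD(3)[OF H]
  have K': "subgroup K G" "K \<subseteq> carrier G" using K subgroup.subset by (auto simp: p_subgroup_def)
  have C: "subgroup C G" unfolding C_def using HG by (rule subgroup_centralizer)
  have D: "subgroup D G" unfolding D_def using K'(2) by (rule subgroup_centralizer)
  have Z: "subgroup Z G" unfolding Z_def using C objsD(2)[OF H] by (simp add: subgroups_Inter_pair)
  have DC: "D \<subseteq> C" unfolding C_def D_def using HK by (rule centralizer_antimono)
  have ZD: "K \<inter> D = Z \<inter> D"
    using Int_centralizer_p_overgroup[OF assms] DC HK by (auto simp: Z_def C_def)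
  have KD: "subgroup (K \<inter> D) G" using K'(1) D by (rule subgroups_Inter_pair)
  then have KDp: "p_subgroup G p (K \<inter> D)" using subgroup_of_p_subgroup K by blast
  then obtain j where j: "card (K \<inter> D) = p ^ j" by (auto simp: p_subgroup_def)
  have pos: "card Z > 0" "card C > 0" "card D > 0" "card (K \<inter> D) > 0"
    using Z C D KD card_sub_pos by blast+
  define m where "m = p'_part p (card C)"
  have m: "card C = m * card Z"
    using card_centralizer_objs[OF H] by (simp add: m_def C_def Z_def)
  have npm: "\<not> p dvd m"
    unfolding m_def p'_part_def using pos prime_p by (intro multiplicity_decompose) auto
  obtain q where q: "card D = card (K \<inter> D) * q"
    using card_subgroup_dvd[OF KD D] by (auto elim: dvdE)
  \<comment> \<open>\<open>C\<close> is partitioned into double cosets of \<open>Z\<close> and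
    \<open>D\<close>. An element \<open>g\<close> of \<open>C\<close> centralizes \<open>H\<close>,
    so it fixes \<open>Z\<close>, whose intersection with \<open>D\<close> is
    \<open>K \<inter> D\<close>; every double coset thus has \<open>card Z * q\<close> elements, and
    \<open>q\<close> divides \<open>m\<close>.\<close>
  have "card ((\<lambda>g. (Z #> g) <#> D) ` C) * (card Z * q) = card C"
  proof (rule card_dcosets[OF Z D])
    show "finite C" "C \<subseteq> carrier G" using C finite_sub subgroup.subset by blast+
    fix g assume g: "g \<in> C"
    show "(Z #> g) <#> D \<subseteq> C"
    proof
      fix x assume "x \<in> (Z #> g) <#> D"
      then obtain z d where "z \<in> Z" "d \<in> D" "x = z \<otimes> g \<otimes> d" by (auto simp: mem_dcoset_iff)
      moreover have "z \<in> C" "d \<in> C" using calculation DC by (auto simp: Z_def)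
      ultimately show "x \<in> C" using g C by (simp add: subgroup.m_closed)
    qed
    have "conjg G g Z = Z"
      using g HG unfolding C_def by (intro conjg_centralized[of g H]) (auto simp: Z_def)
    then have "card ((Z #> g) <#> D) * card (K \<inter> D) = card Z * card D"
      using card_dcoset[OF Z D _ finite_sub[OF Z] finite_sub[OF D], of g] subgroup.mem_carrier[OF C g]
      by (simp add: ZD)
    also have "\<dots> = card Z * q * card (K \<inter> D)" by (simp add: q)
    finally show "card ((Z #> g) <#> D) = card Z * q" using pos by simp
  qed
  then have "card ((\<lambda>g. (Z #> g) <#> D) ` C) * q * card Z = m * card Z" by (simp add: m mult_ac)
  then have "card ((\<lambda>g. (Z #> g) <#> D) ` C) * q = m" using pos by simp
  then have "q dvd m" by (metis dvd_triv_right)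
  then have npq: "\<not> p dvd q" using npm dvd_trans by blast
  \<comment> \<open>As \<open>q\<close> is prime to \<open>p\<close>, the factor
    \<open>p ^ j\<close> is the full \<open>p\<close>-part of \<open>card D\<close>, which makes
    \<open>K \<inter> D\<close> Sylow in \<open>D\<close>.\<close>
  have "Factorial_Ring.multiplicity p (card D) = Factorial_Ring.multiplicity p (p ^ j * q)"
    using q j by simp
  also have "\<dots> = j"
    using npq prime_gt_0_nat[OF prime_p] by (intro multiplicity_eqI) simp_all
  finally have "card (K \<inter> D) = p ^ Factorial_Ring.multiplicity p (card D)" using j by simp
  then show ?thesis
    using K KDp by (simp add: objs_def p_selfcentralizing_def sylow_of_def D_def)
qed

subsection \<open>Morphism sets\<close>

lemma conjg_subgroup_self:
  assumes "subgroup K G" "k \<in> K"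
  shows "conjg G k K \<subseteq> K"
  unfolding conjg_eq_image
  by (rule image_subsetI) (simp add: assms subgroup.m_closed subgroup.m_inv_closed)

text \<open>An element of \<open>C(H)\<close> on the left does not change the conjugate of
  \<open>H\<close>, and an element of \<open>K\<close> on the right moves it within
  \<open>K\<close>.\<close>

lemma transporter_dcoset:
  assumes "H \<subseteq> carrier G" "subgroup K G" "A \<subseteq> centralizer G H" "B \<subseteq> K"
    and g: "g \<in> transporter G H K"
  shows "(A #> g) <#> B \<subseteq> transporter G H K"
proof
  fix x assume "x \<in> (A #> g) <#> B"
  then obtain c k where x: "c \<in> centralizer G H" "k \<in> K" "x = c \<otimes> g \<otimes> k"
    using assms(3,4) by (auto simp: mem_dcoset_iff)
  have c: "c \<in> carrier G" "g \<in> carrier G" "k \<in> carrier G"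
    using x g assms(2) subgroup.mem_carrier by (auto simp: centralizer_def transporter_def)
  have "conjg G x H = conjg G k (conjg G g (conjg G c H))"
    using c assms(1) x(3) by (simp add: conjg_conjg conjg_subset_carrier)
  also have "conjg G c H = H" using conjg_centralized[OF x(1)] assms(1) by blast
  also have "conjg G k (conjg G g H) \<subseteq> conjg G k K"
    using g by (intro conjg_mono) (simp add: transporter_def)
  also have "\<dots> \<subseteq> K" using assms(2) x(2) by (rule conjg_subgroup_self)
  finally show "x \<in> transporter G H K" using c x(3) by (simp add: transporter_def)
qed

lemma finite_transporter: "finite (transporter G H K)"
  unfolding transporter_def using fin by simp

text \<open>With intersections of constant order \<open>c\<close>, all double cosets in the
  transporter have size \<open>card A * card B / c\<close>. One-sided quotients are the cases with
  \<open>A\<close> or \<open>B\<close> trivial.\<close>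

lemma card_transporter_dcosets:
  assumes H: "H \<in> objs G p" and K: "K \<in> objs G p"
    and A: "subgroup A G" "A \<subseteq> centralizer G H" and B: "subgroup B G" "B \<subseteq> K"
    and c: "c > 0" "\<And>g. g \<in> transporter G H K \<Longrightarrow> card (conjg G g A \<inter> B) = c"
  shows "card ((\<lambda>g. (A #> g) <#> B) ` transporter G H K) * (card A * card B)
    = card (transporter G H K) * c"
proof (cases "transporter G H K = {}")
  case False
  let ?s = "card A * card B div c"
  have s: "card ((A #> g) <#> B) * c = card A * card B" if "g \<in> transporter G H K" for g
    using card_dcoset[OF A(1) B(1) _ finite_sub[OF A(1)] finite_sub[OF B(1)], of g] c(2)[OF that] that
    by (simp add: transporter_def)
  \<comment> \<open>Exactness of the division in \<open>?s\<close> is witnessed by any element of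
    the transporter, which is why the empty case is split off.\<close>
  then have sc: "?s * c = card A * card B" using False by (metis dvd_div_mult_self dvd_triv_right ex_in_conv)
  have "card ((\<lambda>g. (A #> g) <#> B) ` transporter G H K) * ?s = card (transporter G H K)"
  proof (rule card_dcosets[OF A(1) B(1) finite_transporter])
    show "transporter G H K \<subseteq> carrier G" by (auto simp: transporter_def)
    fix g assume g: "g \<in> transporter G H K"
    show "(A #> g) <#> B \<subseteq> transporter G H K"
      using objsD(3)[OF H] objsD(2)[OF K] A(2) B(2) g by (rule transporter_dcoset)
    show "card ((A #> g) <#> B) = ?s" using s[OF g] c(1) by (metis div_mult_self_is_m)
  qed
  then show ?thesis using sc by (metis mult.assoc)
qed simp

lemma transporter_carrier: "g \<in> transporter G H K \<Longrightarrow> g \<in> carrier G"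
  by (simp add: transporter_def)

lemma dcoset_one_right: "A \<subseteq> carrier G \<Longrightarrow> g \<in> carrier G \<Longrightarrow> (A #> g) <#> {\<one>} = A #> g"
  by (auto simp: set_mult_def r_coset_def subset_iff)

lemma dcoset_one_left: "g \<in> carrier G \<Longrightarrow> ({\<one>} #> g) <#> B = g <# B"
  by (auto simp: set_mult_def r_coset_def l_coset_def)

text \<open>Supplies the constant \<open>c = 1\<close> for the one-sided quotients.\<close>

lemma conjg_Int_one:
  assumes "subgroup A G" "subgroup B G" "g \<in> carrier G" "A = {\<one>} \<or> B = {\<one>}"
  shows "card (conjg G g A \<inter> B) = 1"
proof -
  have "conjg G g A \<inter> B = {\<one>}"
    using assms subgroup.one_closed[OF subgroup_conjg[OF assms(3,1)]] subgroup.one_closed[OF assms(2)]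
    by (auto simp: conjg_eq_image)
  then show ?thesis by simp
qed

lemma one_centralizer: "H \<subseteq> carrier G \<Longrightarrow> {\<one>} \<subseteq> centralizer G H"
  by (simp add: subgroup.one_closed[OF subgroup_centralizer])

section \<open>Sizes of the hom-sets in the five categories\<close>

lemma card_mor_T: "card (mor_T G p H K) = card (transporter G H K)"
  unfolding mor_T_def by (rule card_image) simp

lemma card_mor_left:
  assumes H: "H \<in> objs G p" and K: "K \<in> objs G p"
    and A: "subgroup A G" "A \<subseteq> centralizer G H"
  shows "card ((\<lambda>g. A #> g) ` transporter G H K) * card A = card (transporter G H K)"
proof -
  have "(\<lambda>g. A #> g) ` transporter G H K = (\<lambda>g. (A #> g) <#> {\<one>}) ` transporter G H K"
    using subgroup.subset[OF A(1)] transporter_carrier by (intro image_cong refl) (metis dcoset_one_right)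
  moreover have "card ((\<lambda>g. (A #> g) <#> {\<one>}) ` transporter G H K) * (card A * card {\<one>})
    = card (transporter G H K) * 1"
    by (rule card_transporter_dcosets[OF H K A])
      (use A(1) triv_subgroup subgroup.one_closed[OF objsD(2)[OF K]] in
        \<open>simp_all add: conjg_Int_one[simplified] transporter_carrier\<close>)
  ultimately show ?thesis by simp
qed

lemma card_mor_F:
  assumes "H \<in> objs G p" "K \<in> objs G p"
  shows "card (mor_F G p H K) * card (centralizer G H) = card (transporter G H K)"
  unfolding mor_F_def
  by (rule card_mor_left[OF assms subgroup_centralizer[OF objsD(3)[OF assms(1)]] subset_refl])

text \<open>\<open>Z(H)\<close> is a Sylow subgroup of \<open>C(H)\<close>, and central there
  because \<open>C(H)\<close> centralizes \<open>H\<close>; hence the subgroup divided out has order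
  equal to the \<open>p'\<close>-part of \<open>card (centralizer G H)\<close>.\<close>

lemma card_mor_L:
  assumes H: "H \<in> objs G p" and K: "K \<in> objs G p"
  shows "card (mor_L G p H K) * p'_part p (card (centralizer G H)) = card (transporter G H K)"
proof -
  let ?C = "centralizer G H"
  note C = subgroup_centralizer[OF objsD(3)[OF H]]
  have Z: "subgroup (H \<inter> ?C) G" using objsD(2)[OF H] C by (rule subgroups_Inter_pair)
  have "z \<otimes> g = g \<otimes> z" if "z \<in> H \<inter> ?C" "g \<in> ?C" for z g
    using that by (auto simp: centralizer_def)
  note Op = card_Op_central_Sylow[OF fin prime_p C Z _ this objsD(4)[OF H]]
  show ?thesis
    using card_mor_left[OF H K Op(2,3)] Op(1) by (simp add: mor_L_def)
qed

lemma card_mor_O: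
  assumes H: "H \<in> objs G p" and K: "K \<in> objs G p"
  shows "card (mor_O G p H K) * card K = card (transporter G H K)"
proof -
  have "mor_O G p H K = (\<lambda>g. ({\<one>} #> g) <#> K) ` transporter G H K"
    unfolding mor_O_def using transporter_carrier by (intro image_cong refl) (metis dcoset_one_left)
  moreover have "card ((\<lambda>g. ({\<one>} #> g) <#> K) ` transporter G H K) * (card {\<one>} * card K)
    = card (transporter G H K) * 1"
    by (rule card_transporter_dcosets[OF H K triv_subgroup one_centralizer[OF objsD(3)[OF H]]
          objsD(2)[OF K] subset_refl])
      (use objsD(2)[OF K] in \<open>simp_all add: conjg_Int_one[simplified] triv_subgroup transporter_carrier\<close>)
  ultimately show ?thesis by simp
qed

text \<open>With both sides nontrivial, the intersection of \<open>K\<close> with the conjugate of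
  \<open>C(H)\<close> is the centre of the conjugate of \<open>H\<close>. Its order is that of
  \<open>Z(H)\<close> for every \<open>g\<close>, and cancelling it leaves only the
  \<open>p'\<close>-part of \<open>card (centralizer G H)\<close>.\<close>

lemma card_mor_Ft:
  assumes H: "H \<in> objs G p" and K: "K \<in> objs G p"
  shows "card (mor_Ft G p H K) * (p'_part p (card (centralizer G H)) * card K) = card (transporter G H K)"
proof -
  let ?C = "centralizer G H"
  note HG = objsD(3)[OF H]
  note C = subgroup_centralizer[OF HG]
  have Z: "card (H \<inter> ?C) > 0" using objsD(2)[OF H] C by (intro card_sub_pos subgroups_Inter_pair)
  have "card (conjg G g ?C \<inter> K) = card (H \<inter> ?C)" if g: "g \<in> transporter G H K" for g
  proof -
    have gG: "g \<in> carrier G" and sub: "conjg G g H \<subseteq> K" using g by (auto simp: transporter_def)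
    have "conjg G g ?C \<inter> K = K \<inter> centralizer G (conjg G g H)"
      using gG HG by (simp add: centralizer_conjg Int_commute)
    also have "\<dots> = conjg G g H \<inter> centralizer G (conjg G g H)"
      using objs_conjg[OF gG H] objsD(1)[OF K] sub by (rule Int_centralizer_p_overgroup)
    also have "\<dots> = conjg G g (H \<inter> ?C)"
      using gG HG by (simp add: centralizer_conjg conjg_Int centralizer_subset_carrier)
    finally show ?thesis using card_conjg[OF gG, of "H \<inter> ?C"] HG by auto
  qed
  from card_transporter_dcosets[OF H K C subset_refl objsD(2)[OF K] subset_refl Z this]
  have "card (mor_Ft G p H K) * (card ?C * card K) = card (transporter G H K) * card (H \<inter> ?C)"
    by (simp add: mor_Ft_def)
  then have "card (mor_Ft G p H K) * (p'_part p (card ?C) * card K) * card (H \<inter> ?C)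
    = card (transporter G H K) * card (H \<inter> ?C)"
    by (subst (asm) card_centralizer_objs[OF H]) (simp add: mult_ac)
  then show ?thesis using Z by simp
qed

end

subsection \<open>Weightings and coweightings\<close>

text \<open>The choice hidden in \<open>euler_char\<close> does not matter: summing
  \<open>v H * card (Hm H K) * k' K\<close> in both orders gives any weighting \<open>k'\<close> the
  same total as the coweighting \<open>v\<close>.\<close>

lemma euler_char_eq_sum_weighting:
  assumes k: "is_weighting Ob Hm k" and v: "is_coweighting Ob Hm v"
  shows "euler_char Ob Hm = (\<Sum>K\<in>Ob. k K)"
proof -
  have eq: "(\<Sum>K\<in>Ob. k' K) = (\<Sum>H\<in>Ob. v H)" if k': "is_weighting Ob Hm k'" for k'
  proof -
    have "(\<Sum>K\<in>Ob. k' K) = (\<Sum>K\<in>Ob. (\<Sum>H\<in>Ob. v H * of_nat (card (Hm H K))) * k' K)"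
      using v by (intro sum.cong) (simp_all add: is_coweighting_def)
    also have "\<dots> = (\<Sum>K\<in>Ob. \<Sum>H\<in>Ob. v H * (of_nat (card (Hm H K)) * k' K))"
      by (simp add: sum_distrib_right mult.assoc)
    also have "\<dots> = (\<Sum>H\<in>Ob. \<Sum>K\<in>Ob. v H * (of_nat (card (Hm H K)) * k' K))"
      by (rule sum.swap)
    also have "\<dots> = (\<Sum>H\<in>Ob. v H * (\<Sum>K\<in>Ob. of_nat (card (Hm H K)) * k' K))"
      by (simp add: sum_distrib_left)
    also have "\<dots> = (\<Sum>H\<in>Ob. v H)"
      using k' by (intro sum.cong) (simp_all add: is_weighting_def)
    finally show ?thesis .
  qed
  have "is_weighting Ob Hm (SOME k. is_weighting Ob Hm k)" using k by (rule someI[of "is_weighting Ob Hm"])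
  then show ?thesis unfolding euler_char_def using eq[OF k] eq by metis
qed

section \<open>Moebius inversion over the objects\<close>

context p_local
begin

text \<open>Every subgroup between \<open>H\<close> and \<open>L\<close> is a \<open>p\<close>-group
  above an object, hence an object; objects not below \<open>L\<close> contribute zero. So the sum
  over objects equals the sum over the full interval.\<close>

lemma sum_mu_objs_lower:
  assumes H: "H \<in> objs G p" and L: "L \<in> objs G p"
  shows "(\<Sum>K \<in> {K \<in> objs G p. H \<subseteq> K}. mu G K L) = (if H = L then 1 else 0)"
proof (cases "H \<subseteq> L")
  case True
  have "(\<Sum>K \<in> {K \<in> objs G p. H \<subseteq> K}. mu G K L) = (\<Sum>K \<in> {K. subgroup K G \<and> H \<subseteq> K \<and> K \<subseteq> L}. mu G K L)"
  proof (rule sum.mono_neutral_right)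
    show "finite {K \<in> objs G p. H \<subseteq> K}" using finite_objs by simp
    show "{K. subgroup K G \<and> H \<subseteq> K \<and> K \<subseteq> L} \<subseteq> {K \<in> objs G p. H \<subseteq> K}"
      using objs_p_overgroup[OF H] subgroup_of_p_subgroup[OF _ objsD(1)[OF L]] by blast
    show "\<forall>K\<in>{K \<in> objs G p. H \<subseteq> K} - {K. subgroup K G \<and> H \<subseteq> K \<and> K \<subseteq> L}. mu G K L = 0"
      using objsD(2) mu_not_subset by blast
  qed
  then show ?thesis
    using sum_mu_lower[OF finite_sub[OF objsD(2)[OF L]] objsD(2)[OF H] objsD(2)[OF L] True] by simp
next
  case False
  then have "(\<Sum>K \<in> {K \<in> objs G p. H \<subseteq> K}. mu G K L) = 0"
    by (intro sum.neutral ballI mu_not_subset) blast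
  then show ?thesis using False by auto
qed

lemma sum_mu_objs_upper:
  assumes H: "H \<in> objs G p" and L: "L \<in> objs G p"
  shows "(\<Sum>K \<in> {K \<in> objs G p. K \<subseteq> L}. mu G H K) = (if H = L then 1 else 0)"
proof (cases "H \<subseteq> L")
  case True
  have "(\<Sum>K \<in> {K \<in> objs G p. K \<subseteq> L}. mu G H K) = (\<Sum>K \<in> {K. subgroup K G \<and> H \<subseteq> K \<and> K \<subseteq> L}. mu G H K)"
  proof (rule sum.mono_neutral_right)
    show "finite {K \<in> objs G p. K \<subseteq> L}" using finite_objs by simp
    show "{K. subgroup K G \<and> H \<subseteq> K \<and> K \<subseteq> L} \<subseteq> {K \<in> objs G p. K \<subseteq> L}"
      using objs_p_overgroup[OF H] subgroup_of_p_subgroup[OF _ objsD(1)[OF L]] by blast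
    show "\<forall>K\<in>{K \<in> objs G p. K \<subseteq> L} - {K. subgroup K G \<and> H \<subseteq> K \<and> K \<subseteq> L}. mu G H K = 0"
      using objsD(2) mu_not_subset by blast
  qed
  then show ?thesis
    using sum_mu_upper[OF finite_sub[OF objsD(2)[OF L]] objsD(2)[OF H] objsD(2)[OF L] True] by simp
next
  case False
  then have "(\<Sum>K \<in> {K \<in> objs G p. K \<subseteq> L}. mu G H K) = 0"
    by (intro sum.neutral ballI mu_not_subset) blast
  then show ?thesis using False by auto
qed

section \<open>Invariance under conjugation and the transporter matrix\<close>

lemma bij_betw_conjg_objs:
  assumes g: "g \<in> carrier G"
  shows "bij_betw (conjg G g) (objs G p) (objs G p)"
  by (rule bij_betw_byWitness[of _ "conjg G (inv g)"])
    (use g objsD(3) in \<open>auto simp: conjg_inv_conjg objs_conjg\<close>)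

lemma sum_conjg_objs:
  assumes "g \<in> carrier G"
  shows "(\<Sum>K\<in>objs G p. f (conjg G g K)) = (\<Sum>K\<in>objs G p. f K)"
  by (rule sum.reindex_bij_betw[OF bij_betw_conjg_objs[OF assms]])

text \<open>Right translation by \<open>g\<close> is a bijection between the two transporters. This
  makes the summands of a weighting equation constant on target classes.\<close>

lemma card_transporter_conjg:
  assumes "g \<in> carrier G" "H \<in> objs G p" "K \<in> objs G p"
  shows "card (transporter G H (conjg G g K)) = card (transporter G H K)"
proof (rule bij_betw_same_card[symmetric])
  note c = assms(1) objsD(3)[OF assms(2)] objsD(3)[OF assms(3)]
  have "x \<otimes> g \<in> transporter G H (conjg G g K)" if "x \<in> transporter G H K" for x
    using that c by (auto simp: transporter_def conjg_conjg[symmetric] intro: conjg_mono[THEN subsetD])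
  moreover have "x \<otimes> inv g \<in> transporter G H K" if "x \<in> transporter G H (conjg G g K)" for x
  proof -
    have x: "x \<in> carrier G" "conjg G x H \<subseteq> conjg G g K" using that by (auto simp: transporter_def)
    have "conjg G (x \<otimes> inv g) H = conjg G (inv g) (conjg G x H)" using x c by (simp add: conjg_conjg)
    also have "\<dots> \<subseteq> conjg G (inv g) (conjg G g K)" using x by (intro conjg_mono)
    also have "\<dots> = K" using c by (simp add: conjg_inv_conjg)
    finally show ?thesis using x c by (simp add: transporter_def)
  qed
  moreover have "x \<otimes> g \<otimes> inv g = x" "x \<otimes> inv g \<otimes> g = x" if "x \<in> carrier G" for x
    using that c by (simp_all add: m_assoc)
  ultimately show "bij_betw (\<lambda>x. x \<otimes> g) (transporter G H K) (transporter G H (conjg G g K))"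
    by (intro bij_betw_byWitness[where f' = "\<lambda>x. x \<otimes> inv g"] ballI image_subsetI)
      (simp_all add: transporter_carrier)
qed

text \<open>Separates the elements \<open>g\<close>, so that Moebius inversion can be applied to
  each inclusion relation in turn.\<close>

lemma card_transporter_eq_sum:
  "of_nat (card (transporter G H K)) = (\<Sum>g\<in>carrier G. if conjg G g H \<subseteq> K then 1 else (0::rat))"
proof -
  have "(\<Sum>g\<in>carrier G. if conjg G g H \<subseteq> K then 1 else (0::rat)) = (\<Sum>g\<in>transporter G H K. 1)"
    unfolding transporter_def by (rule sum.mono_neutral_cong_right) (use fin in auto)
  then show ?thesis by simp
qed

lemma card_carrier_nonzero: "(of_nat (card (carrier G)) :: rat) \<noteq> 0"
  using fin by (auto simp: card_eq_0_iff)

section \<open>Passing between sums over objects and sums over classes\<close>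

lemma Xc_rep:
  assumes "c \<in> Xc G p"
  shows "rep c \<in> c" "rep c \<in> objs G p" "conjclass G (rep c) = c" "c \<subseteq> objs G p"
proof -
  obtain K where K: "K \<in> objs G p" "c = conjclass G K" using assms by (auto simp: Xc_def)
  show sub: "c \<subseteq> objs G p" using K objs_conjg by (auto simp: conjclass_def)
  show "rep c \<in> c" unfolding rep_def
    using someI[of "\<lambda>x. x \<in> c" K] conjclass_refl[OF objsD(3)[OF K(1)]] K(2) by simp
  then show "rep c \<in> objs G p" "conjclass G (rep c) = c"
    using sub conjclass_eq[OF objsD(3)[OF K(1)]] K(2) by auto
qed

lemma sum_Xc: "(\<Sum>c\<in>Xc G p. \<Sum>K\<in>c. f K) = (\<Sum>K\<in>objs G p. f K)"
proof -
  have U: "\<Union>(Xc G p) = objs G p"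
  proof
    show "\<Union>(Xc G p) \<subseteq> objs G p" using Xc_rep(4) by (intro Union_least)
    show "objs G p \<subseteq> \<Union>(Xc G p)" using conjclass_refl objsD(3) by (auto simp: Xc_def)
  qed
  have "sum f (\<Union>(Xc G p)) = (sum \<circ> sum) f (Xc G p)"
  proof (rule sum.Union_disjoint)
    show "\<forall>A\<in>Xc G p. finite A" using Xc_rep(4) finite_objs finite_subset by blast
    show "\<forall>A\<in>Xc G p. \<forall>B\<in>Xc G p. A \<noteq> B \<longrightarrow> A \<inter> B = {}"
    proof (intro ballI impI)
      fix A B assume A: "A \<in> Xc G p" and B: "B \<in> Xc G p" and ne: "A \<noteq> B"
      have "A = B" if "K \<in> A" "K \<in> B" for K
        using conjclass_eq[of "rep A" K] conjclass_eq[of "rep B" K] that Xc_rep[OF A] Xc_rep[OF B]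
        by (simp add: objsD(3))
      then show "A \<inter> B = {}" using ne by blast
    qed
  qed
  then show ?thesis by (simp add: U)
qed

definition class_fun :: "('a set \<Rightarrow> 'c) \<Rightarrow> bool" where
  "class_fun f \<longleftrightarrow> (\<forall>g\<in>carrier G. \<forall>K\<in>objs G p. f (conjg G g K) = f K)"

lemma class_fun_rep:
  assumes "class_fun f" "c \<in> Xc G p" "K \<in> c"
  shows "f K = f (rep c)"
proof -
  have "K \<in> conjclass G (rep c)" using Xc_rep(3)[OF assms(2)] assms(3) by simp
  then obtain g where "g \<in> carrier G" "K = conjg G g (rep c)" by (auto simp: conjclass_def)
  then show ?thesis using assms(1) Xc_rep(2)[OF assms(2)] by (simp add: class_fun_def)
qed

lemma sum_class_fun:
  fixes f :: "'a set \<Rightarrow> rat"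
  assumes "class_fun f"
  shows "(\<Sum>c\<in>Xc G p. of_nat (card c) * f (rep c)) = (\<Sum>K\<in>objs G p. f K)"
proof -
  have "(\<Sum>K\<in>c. f K) = of_nat (card c) * f (rep c)" if "c \<in> Xc G p" for c
    using class_fun_rep[OF assms that] by simp
  then show ?thesis using sum_Xc[of f] by simp
qed

text \<open>Trades the normalizer factor in \<open>mu_cl\<close> for a class size, which a sum over
  objects absorbs.\<close>

lemma card_class_normalizer:
  assumes "c \<in> Xc G p"
  shows "1 / of_nat (card (normalizer G (rep c))) = (of_nat (card c) / of_nat (card (carrier G)) :: rat)"
proof -
  have "card c * card (normalizer G (rep c)) = card (carrier G)"
    using card_conjclass[OF objsD(3)[OF Xc_rep(2)[OF assms]]] Xc_rep(3)[OF assms] by simp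
  then have "of_nat (card c) * of_nat (card (normalizer G (rep c))) = (of_nat (card (carrier G)) :: rat)"
    by (metis of_nat_mult)
  moreover have "(of_nat (card (normalizer G (rep c))) :: rat) \<noteq> 0"
    using calculation card_carrier_nonzero by force
  ultimately show ?thesis using card_carrier_nonzero by (simp add: field_simps)
qed

text \<open>The factors \<open>a\<close> and \<open>b\<close> scale the rows and columns of the
  transporter matrix \<open>T\<close>. A weighting \<open>w\<close> must satisfy
  \<open>T (w / b) = a\<close>; the Moebius inverse of \<open>a\<close> solves this up to the factor
  \<open>card (carrier G)\<close>, since each \<open>g\<close> contributes \<open>a\<close> at a
  conjugate of \<open>H\<close>, which is \<open>a H\<close>. Coweightings are dual.\<close>

lemma weightings_of_transporter_quotient:
  fixes a b :: "'a set \<Rightarrow> rat" and Hm :: "'a set \<Rightarrow> 'a set \<Rightarrow> 'c set"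
  assumes a: "class_fun a" "\<And>H. H \<in> objs G p \<Longrightarrow> a H \<noteq> 0"
    and b: "class_fun b" "\<And>H. H \<in> objs G p \<Longrightarrow> b H \<noteq> 0"
    and Hm: "\<And>H K. H \<in> objs G p \<Longrightarrow> K \<in> objs G p \<Longrightarrow>
      of_nat (card (Hm H K)) * (a H * b K) = of_nat (card (transporter G H K))"
  shows "is_class_weighting (Xc G p) (objs G p) Hm
      (\<lambda>c. b (rep c) * (\<Sum>d \<in> Xc G p. mu_cl G (rep c) (rep d) * a (rep d)))
     \<and> is_coweighting (objs G p) Hm
      (\<lambda>K. a K / of_nat (card (carrier G)) * (\<Sum>H \<in> objs G p. b H * of_int (mu G H K)))
     \<and> has_euler_char (objs G p) Hm
     \<and> euler_char (objs G p) Hm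
      = (\<Sum>c \<in> Xc G p. \<Sum>d \<in> Xc G p. b (rep c) * mu_cl G (rep c) (rep d) * a (rep d))"
proof -
  let ?O = "objs G p"
  define n :: rat where "n = of_nat (card (carrier G))"
  have n0: "n \<noteq> 0" unfolding n_def by (rule card_carrier_nonzero)
  have a': "a (conjg G g K) = a K" and b': "b (conjg G g K) = b K"
    if "g \<in> carrier G" "K \<in> ?O" for g K
    using a(1) b(1) that by (auto simp: class_fun_def)
  \<comment> \<open>\<open>S\<close> is the Moebius inverse of \<open>a\<close> over larger objects,
    and \<open>w\<close> the resulting weighting on objects; \<open>k\<close> will be its total over
    a class.\<close>
  define S where "S K = (\<Sum>L\<in>?O. of_int (mu G K L) * a L)" for K
  define w where "w K = b K * S K / n" for K
  define k where "k c = b (rep c) * (\<Sum>d \<in> Xc G p. mu_cl G (rep c) (rep d) * a (rep d))" for c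
  define v where "v K = a K / n * (\<Sum>H \<in> ?O. b H * of_int (mu G H K))" for K

  have Sg: "S (conjg G g K) = S K" if g: "g \<in> carrier G" and K: "K \<in> ?O" for g K
  proof -
    have "S (conjg G g K) = (\<Sum>L\<in>?O. of_int (mu G (conjg G g K) (conjg G g L)) * a (conjg G g L))"
      unfolding S_def by (rule sum_conjg_objs[OF g, symmetric])
    also have "\<dots> = S K"
      unfolding S_def using g K
      by (intro sum.cong refl) (simp add: a' mu_conjg objsD(2,3) finite_sub)
    finally show ?thesis .
  qed
  have w_class: "class_fun w" by (simp add: class_fun_def w_def Sg b')

  \<comment> \<open>The factor \<open>card c\<close> arises from the normalizer in
    \<open>mu_cl\<close>; on a class the invariant \<open>w\<close> sums to
    \<open>card c * w (rep c)\<close>.\<close>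
  have k_eq: "k c = of_nat (card c) * w (rep c)" if c: "c \<in> Xc G p" for c
  proof -
    have "mu_cl G (rep c) (rep d) * a (rep d)
      = 1 / of_nat (card (normalizer G (rep c))) * (\<Sum>L\<in>d. of_int (mu G (rep c) L) * a L)"
      if d: "d \<in> Xc G p" for d
    proof -
      have "(\<Sum>L\<in>d. of_int (mu G (rep c) L) * a L) = (\<Sum>L\<in>d. of_int (mu G (rep c) L)) * a (rep d)"
        unfolding sum_distrib_right by (intro sum.cong refl) (simp add: class_fun_rep[OF a(1) d])
      then show ?thesis by (simp add: mu_cl_def Xc_rep(3)[OF d])
    qed
    then have "(\<Sum>d \<in> Xc G p. mu_cl G (rep c) (rep d) * a (rep d))
      = 1 / of_nat (card (normalizer G (rep c))) * (\<Sum>d \<in> Xc G p. \<Sum>L\<in>d. of_int (mu G (rep c) L) * a L)"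
      unfolding sum_distrib_left[where A = "Xc G p"] by (intro sum.cong refl)
    also have "\<dots> = of_nat (card c) / n * S (rep c)"
      unfolding S_def n_def by (simp only: sum_Xc card_class_normalizer[OF c])
    finally show ?thesis by (simp add: k_def w_def)
  qed

  \<comment> \<open>Multiplying by \<open>w K\<close> cancels the column factor \<open>b K\<close>;
    the row factor \<open>a H\<close> is left to be matched by inversion.\<close>
  have Hm_w: "of_nat (card (Hm H K)) * w K = of_nat (card (transporter G H K)) * S K / (a H * n)"
    if "H \<in> ?O" "K \<in> ?O" for H K
    using a(2)[OF that(1)] b(2)[OF that(2)] n0 by (simp add: w_def Hm[OF that, symmetric])

  have weighting: "(\<Sum>K\<in>?O. of_nat (card (Hm H K)) * w K) = 1" if H: "H \<in> ?O" for H
  proof -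
    have "(\<Sum>K\<in>?O. of_nat (card (transporter G H K)) * S K)
      = (\<Sum>K\<in>?O. \<Sum>g\<in>carrier G. (if conjg G g H \<subseteq> K then S K else 0))"
      unfolding card_transporter_eq_sum sum_distrib_right by (intro sum.cong refl) simp
    also have "\<dots> = (\<Sum>g\<in>carrier G. \<Sum>K\<in>?O. (if conjg G g H \<subseteq> K then S K else 0))"
      by (rule sum.swap)
    also have "\<dots> = (\<Sum>g\<in>carrier G. a H)"
    proof (intro sum.cong refl)
      fix g assume g: "g \<in> carrier G"
      let ?H = "conjg G g H"
      have H': "?H \<in> ?O" using g H by (rule objs_conjg)
      have "(\<Sum>K\<in>?O. (if ?H \<subseteq> K then S K else 0)) = (\<Sum>K\<in>{K\<in>?O. ?H \<subseteq> K}. S K)"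
        by (rule sum.inter_filter[OF finite_objs, symmetric])
      also have "\<dots> = (\<Sum>L\<in>?O. \<Sum>K\<in>{K\<in>?O. ?H \<subseteq> K}. of_int (mu G K L) * a L)"
        unfolding S_def by (rule sum.swap)
      also have "\<dots> = (\<Sum>L\<in>?O. of_int (\<Sum>K\<in>{K\<in>?O. ?H \<subseteq> K}. mu G K L) * a L)"
        by (simp add: sum_distrib_right)
      also have "\<dots> = (\<Sum>L\<in>?O. if L = ?H then a L else 0)"
        by (intro sum.cong refl) (simp add: sum_mu_objs_lower[OF H'])
      also have "\<dots> = a H" using H' g H by (simp add: finite_objs a')
      finally show "(\<Sum>K\<in>?O. (if ?H \<subseteq> K then S K else 0)) = a H" .
    qed
    finally have "(\<Sum>K\<in>?O. of_nat (card (transporter G H K)) * S K) = n * a H" by (simp add: n_def)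
    then have "(\<Sum>K\<in>?O. of_nat (card (transporter G H K)) * S K / (a H * n)) = 1"
      using a(2)[OF H] n0 by (simp flip: sum_divide_distrib)
    then show ?thesis using Hm_w[OF H] by simp
  qed

  have "(\<Sum>c\<in>Xc G p. of_nat (card (Hm H (rep c))) * k c) = 1" if H: "H \<in> ?O" for H
  proof -
    \<comment> \<open>Nothing is assumed about how \<open>Hm\<close> varies along a class, so the
      passage to sums over objects goes through this expression, which is visibly a class
      function.\<close>
    define F where "F K = of_nat (card (transporter G H K)) * S K / (a H * n)" for K
    have "class_fun F" by (simp add: class_fun_def F_def Sg card_transporter_conjg H)
    moreover have "of_nat (card (Hm H (rep c))) * k c = of_nat (card c) * F (rep c)" if "c \<in> Xc G p" for c
      using Hm_w[OF H Xc_rep(2)[OF that]] by (simp add: k_eq[OF that] F_def mult.left_commute)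
    ultimately have "(\<Sum>c\<in>Xc G p. of_nat (card (Hm H (rep c))) * k c) = (\<Sum>K\<in>?O. F K)"
      using sum_class_fun[of F] by simp
    also have "\<dots> = (\<Sum>K\<in>?O. of_nat (card (Hm H K)) * w K)"
      unfolding F_def using Hm_w[OF H] by simp
    finally show ?thesis using weighting[OF H] by simp
  qed
  then have class_weighting: "is_class_weighting (Xc G p) ?O Hm k"
    by (simp add: is_class_weighting_def)
  have is_w: "is_weighting ?O Hm w" using weighting by (simp add: is_weighting_def)

  have "(\<Sum>H\<in>?O. v H * of_nat (card (Hm H K))) = 1" if K: "K \<in> ?O" for K
  proof -
    \<comment> \<open>Dual of \<open>S\<close>: the Moebius inverse of \<open>b\<close> over smaller
      objects, with \<open>inv g\<close> now conjugating the target.\<close>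
    define U where "U H = (\<Sum>L \<in> ?O. b L * of_int (mu G L H))" for H
    have Hm_v: "v H * of_nat (card (Hm H K)) = U H * of_nat (card (transporter G H K)) / (b K * n)"
      if "H \<in> ?O" for H
      using a(2)[OF that] b(2)[OF K] n0 by (simp add: v_def U_def Hm[OF that K, symmetric])
    have "(\<Sum>H\<in>?O. U H * of_nat (card (transporter G H K)))
      = (\<Sum>H\<in>?O. \<Sum>g\<in>carrier G. (if H \<subseteq> conjg G (inv g) K then U H else 0))"
      unfolding card_transporter_eq_sum sum_distrib_left
      by (intro sum.cong refl) (simp add: conjg_subset_conjg_inv_iff objsD(3) K)
    also have "\<dots> = (\<Sum>g\<in>carrier G. \<Sum>H\<in>?O. (if H \<subseteq> conjg G (inv g) K then U H else 0))"
      by (rule sum.swap)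
    also have "\<dots> = (\<Sum>g\<in>carrier G. b K)"
    proof (intro sum.cong refl)
      fix g assume g: "g \<in> carrier G"
      let ?K = "conjg G (inv g) K"
      have K': "?K \<in> ?O" using inv_closed[OF g] K by (rule objs_conjg)
      have "(\<Sum>H\<in>?O. (if H \<subseteq> ?K then U H else 0)) = (\<Sum>H\<in>{H\<in>?O. H \<subseteq> ?K}. U H)"
        by (rule sum.inter_filter[OF finite_objs, symmetric])
      also have "\<dots> = (\<Sum>L\<in>?O. \<Sum>H\<in>{H\<in>?O. H \<subseteq> ?K}. b L * of_int (mu G L H))"
        unfolding U_def by (rule sum.swap)
      also have "\<dots> = (\<Sum>L\<in>?O. b L * of_int (\<Sum>H\<in>{H\<in>?O. H \<subseteq> ?K}. mu G L H))"
        by (simp add: sum_distrib_left)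
      also have "\<dots> = (\<Sum>L\<in>?O. if L = ?K then b L else 0)"
        by (intro sum.cong refl) (simp add: sum_mu_objs_upper[OF _ K'])
      also have "\<dots> = b K" using K' g K by (simp add: finite_objs b')
      finally show "(\<Sum>H\<in>?O. (if H \<subseteq> ?K then U H else 0)) = b K" .
    qed
    finally have "(\<Sum>H\<in>?O. U H * of_nat (card (transporter G H K))) = n * b K" by (simp add: n_def)
    then have "(\<Sum>H\<in>?O. U H * of_nat (card (transporter G H K)) / (b K * n)) = 1"
      using b(2)[OF K] n0 by (simp flip: sum_divide_distrib)
    then show ?thesis using Hm_v by simp
  qed
  then have is_v: "is_coweighting ?O Hm v" by (simp add: is_coweighting_def)

  \<comment> \<open>\<open>euler_char\<close> refers to weightings on objects, so its value is read
    off \<open>w\<close> first and then regrouped into \<open>k\<close>.\<close>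
  have "euler_char ?O Hm = (\<Sum>K\<in>?O. w K)" using is_w is_v by (rule euler_char_eq_sum_weighting)
  also have "\<dots> = (\<Sum>c\<in>Xc G p. k c)" using sum_class_fun[OF w_class] k_eq by simp
  also have "\<dots> = (\<Sum>c \<in> Xc G p. \<Sum>d \<in> Xc G p. b (rep c) * mu_cl G (rep c) (rep d) * a (rep d))"
    by (simp add: k_def sum_distrib_left mult.assoc)
  finally show ?thesis
    using class_weighting is_v is_w unfolding k_def v_def n_def has_euler_char_def by blast
qed

lemma class_fun_const: "class_fun (\<lambda>_. x)"
  by (simp add: class_fun_def)

lemma class_fun_card: "class_fun (\<lambda>K. f (card K))"
  by (simp add: class_fun_def card_conjg objsD(3))

lemma class_fun_card_centralizer: "class_fun (\<lambda>K. f (card (centralizer G K)))"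
  by (simp add: class_fun_def card_centralizer_conjg objsD(3))

end

theorem theorem8p3:
  fixes G :: "('a, 'b) monoid_scheme" and p :: nat
  assumes "group G" and "finite (carrier G)" and "Factorial_Ring.prime p"
  shows "      (is_class_weighting (Xc G p) (objs G p) (mor_T G p) (\<lambda>c. 1 * (\<Sum>d \<in> Xc G p. mu_cl G (rep c) (rep d) * 1))
     \<and> is_coweighting (objs G p) (mor_T G p) (\<lambda>K. 1 / of_nat (card (carrier G)) * (\<Sum>H \<in> objs G p. 1 * of_int (mu G H K)))
     \<and> has_euler_char (objs G p) (mor_T G p)
     \<and> euler_char (objs G p) (mor_T G p) = (\<Sum>c \<in> Xc G p. \<Sum>d \<in> Xc G p. 1 * mu_cl G (rep c) (rep d) * 1))
   \<and>
      (is_class_weighting (Xc G p) (objs G p) (mor_L G p) (\<lambda>c. 1 * (\<Sum>d \<in> Xc G p. mu_cl G (rep c) (rep d) * of_nat (p'_part p (card (centralizer G (rep d))))))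
     \<and> is_coweighting (objs G p) (mor_L G p) (\<lambda>K. of_nat (p'_part p (card (centralizer G K))) / of_nat (card (carrier G)) * (\<Sum>H \<in> objs G p. 1 * of_int (mu G H K)))
     \<and> has_euler_char (objs G p) (mor_L G p)
     \<and> euler_char (objs G p) (mor_L G p) = (\<Sum>c \<in> Xc G p. \<Sum>d \<in> Xc G p. 1 * mu_cl G (rep c) (rep d) * of_nat (p'_part p (card (centralizer G (rep d))))))
   \<and>
      (is_class_weighting (Xc G p) (objs G p) (mor_F G p) (\<lambda>c. 1 * (\<Sum>d \<in> Xc G p. mu_cl G (rep c) (rep d) * of_nat (card (centralizer G (rep d)))))
     \<and> is_coweighting (objs G p) (mor_F G p) (\<lambda>K. of_nat (card (centralizer G K)) / of_nat (card (carrier G)) * (\<Sum>H \<in> objs G p. 1 * of_int (mu G H K)))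
     \<and> has_euler_char (objs G p) (mor_F G p)
     \<and> euler_char (objs G p) (mor_F G p) = (\<Sum>c \<in> Xc G p. \<Sum>d \<in> Xc G p. 1 * mu_cl G (rep c) (rep d) * of_nat (card (centralizer G (rep d)))))
   \<and>
      (is_class_weighting (Xc G p) (objs G p) (mor_O G p) (\<lambda>c. of_nat (card (rep c)) * (\<Sum>d \<in> Xc G p. mu_cl G (rep c) (rep d) * 1))
     \<and> is_coweighting (objs G p) (mor_O G p) (\<lambda>K. 1 / of_nat (card (carrier G)) * (\<Sum>H \<in> objs G p. of_nat (card H) * of_int (mu G H K)))
     \<and> has_euler_char (objs G p) (mor_O G p)
     \<and> euler_char (objs G p) (mor_O G p) = (\<Sum>c \<in> Xc G p. \<Sum>d \<in> Xc G p. of_nat (card (rep c)) * mu_cl G (rep c) (rep d) * 1))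
   \<and>
      (is_class_weighting (Xc G p) (objs G p) (mor_Ft G p) (\<lambda>c. of_nat (card (rep c)) * (\<Sum>d \<in> Xc G p. mu_cl G (rep c) (rep d) * of_nat (p'_part p (card (centralizer G (rep d))))))
     \<and> is_coweighting (objs G p) (mor_Ft G p) (\<lambda>K. of_nat (p'_part p (card (centralizer G K))) / of_nat (card (carrier G)) * (\<Sum>H \<in> objs G p. of_nat (card H) * of_int (mu G H K)))
     \<and> has_euler_char (objs G p) (mor_Ft G p)
     \<and> euler_char (objs G p) (mor_Ft G p) = (\<Sum>c \<in> Xc G p. \<Sum>d \<in> Xc G p. of_nat (card (rep c)) * mu_cl G (rep c) (rep d) * of_nat (p'_part p (card (centralizer G (rep d))))))"
proof -
  interpret group G by fact
  interpret p_local G p by unfold_locales fact+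
  note q = weightings_of_transporter_quotient
  have pos: "card K > 0" "card (centralizer G K) > 0" "p'_part p (card (centralizer G K)) > 0"
    if "K \<in> objs G p" for K
    using that by (simp_all add: card_sub_pos card_centralizer_pos p'_part_pos objsD)
  note cf = class_fun_const class_fun_card[where f = of_nat]
    class_fun_card_centralizer[where f = of_nat] class_fun_card_centralizer[where f = "\<lambda>m. of_nat (p'_part p m)"]
  show ?thesis
  \<comment> \<open>In each case \<open>b\<close> is the order of the group divided out on the right
    and \<open>a\<close> that on the left, except that in the last one \<open>Z(H)\<close> is
    already absorbed by \<open>K\<close>, so only the \<open>p'\<close>-part of
    \<open>card (centralizer G K)\<close> enters \<open>a\<close>.\<close>
  proof (intro conjI[OF _ conjI[OF _ conjI[OF _ conjI]]], goal_cases)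
    case 1 show ?case
      by (rule q[of "\<lambda>_. 1" "\<lambda>_. 1"]) (simp_all add: cf card_mor_T)
  next
    case 2 show ?case
      by (rule q[of "\<lambda>K. of_nat (p'_part p (card (centralizer G K)))" "\<lambda>_. 1"])
        (use pos in \<open>simp_all add: cf flip: card_mor_L\<close>)
  next
    case 3 show ?case
      by (rule q[of "\<lambda>K. of_nat (card (centralizer G K))" "\<lambda>_. 1"])
        (use pos in \<open>simp_all add: cf flip: card_mor_F\<close>)
  next
    case 4 show ?case
      by (rule q[of "\<lambda>_. 1" "\<lambda>K. of_nat (card K)"])
        (use pos in \<open>simp_all add: cf flip: card_mor_O\<close>)
  next
    case 5 show ?case
      by (rule q[of "\<lambda>K. of_nat (p'_part p (card (centralizer G K)))" "\<lambda>K. of_nat (card K)"])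
        (use pos in \<open>simp_all add: cf flip: card_mor_Ft\<close>)
  qed
qed

end
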